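(* Let $\{\mathcal{T}(t)\}_{t\ge 0}$ be the symmetric telegraph process with speed $c>0$ and rate $\lambda>0$, and let $t>0$. For every integer $k\ge 1$ and $0<\beta<ct$, $$P\Bigl\{ \max_{0\le s\le t} \mathcal{T}(s) \in d\beta \,\Big|\, V(0) = -c,\ N(t) = 2k\Bigr\} = \frac{2(2k)!}{k!(k-1)!}\, \frac{(c^2t^2 - \beta^2)^{k-1}(ct-\beta)}{(2ct)^{2k}}\,d\beta ,$$ and for every integer $k\ge 0$, $$P\Bigl\{ \max_{0\le s\le t} \mathcal{T}(s) = 0 \,\Big|\, V(0) = -c,\ N(t) = 2k\Bigr\} = \binom{2k}{k}\frac{1}{2^{2k}} .$$
   Context: Let $c>0$, $\lambda>0$. Let $V(0)$ be a random variable with $P\{V(0)=c\}=P\{V(0)=-c\}=\tfrac12$ and let $\{N(t)\}_{t\ge0}$ be a homogeneous Poisson process with rate $\lambda$, independent of $V(0)$. The symmetric telegraph process is $\mathcal{T}(t)=\int_0^t V(0)(-1)^{N(s)}\,ds$, $t\ge 0$ (so $\mathcal{T}(0)=0$). A formula $P\{X\in d\beta\mid A\}=f(\beta)\,d\beta$ for $0<\beta<ct$ means that the conditional law of $X$ given the event $A$, restricted to the open interval $(0,ct)$, is absolutely continuous with density $f$. *)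

theory Defs
  imports "HOL-Probability.Probability"
begin

locale poisson_process = prob_space M
  for M :: "'a measure" +
  fixes rate :: real and N :: "real \<Rightarrow> 'a \<Rightarrow> nat"
  assumes rate_pos: "0 < rate"
    and N_measurable: "\<And>s. 0 \<le> s \<Longrightarrow> N s \<in> measurable M (count_space UNIV)"
    and N_zero: "\<And>\<omega>. \<omega> \<in> space M \<Longrightarrow> N 0 \<omega> = 0"
    and N_mono: "\<And>\<omega>. \<omega> \<in> space M \<Longrightarrow> mono_on {0..} (\<lambda>s. N s \<omega>)"
    and N_right_continuous:
      "\<And>\<omega> s. \<omega> \<in> space M \<Longrightarrow> 0 \<le> s \<Longrightarrow> continuous (at_right s) (\<lambda>u. N u \<omega>)"
    and N_indep_increments:
      "\<And>(n::nat) \<tau> :: nat \<Rightarrow> real. 0 \<le> \<tau> 0 \<Longrightarrow> strict_mono_on {..n} \<tau> \<Longrightarrow>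
        indep_vars (\<lambda>_. count_space UNIV) (\<lambda>i \<omega>. N (\<tau> (Suc i)) \<omega> - N (\<tau> i) \<omega>) {..<n}"
    and N_increments:
      "\<And>s u. 0 \<le> s \<Longrightarrow> s < u \<Longrightarrow>
        distr M (count_space UNIV) (\<lambda>\<omega>. N u \<omega> - N s \<omega>) =
        measure_pmf (poisson_pmf (rate * (u - s)))"

text \<open>The sigma-algebras generated by the initial velocity and by the whole path of the counting
  process are independent; \<open>indep_var\<close> is not applicable since the two have different value types.\<close>

locale symmetric_telegraph = poisson_process M rate N
  for M :: "'a measure" and rate :: real and N :: "real \<Rightarrow> 'a \<Rightarrow> nat" +
  fixes c :: real and V0 :: "'a \<Rightarrow> real"
  assumes c_pos: "0 < c"
    and V0_measurable: "V0 \<in> borel_measurable M"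
    and V0_pos: "\<P>(\<omega> in M. V0 \<omega> = c) = 1 / 2"
    and V0_neg: "\<P>(\<omega> in M. V0 \<omega> = - c) = 1 / 2"
    and V0_indep:
      "indep_set (sets (vimage_algebra (space M) V0 borel))
        (sets (vimage_algebra (space M) (\<lambda>\<omega>. \<lambda>s\<in>{0..}. N s \<omega>)
          (PiM {0..} (\<lambda>_. count_space UNIV))))"

definition telegraph :: "(real \<Rightarrow> 'a \<Rightarrow> nat) \<Rightarrow> ('a \<Rightarrow> real) \<Rightarrow> real \<Rightarrow> 'a \<Rightarrow> real" where
  "telegraph N V0 t \<omega> = integral {0..t} (\<lambda>s. V0 \<omega> * (-1) ^ N s \<omega>)"

text \<open>For a telegraph process this supremum is a maximum: see
  \<open>symmetric_telegraph.running_max_attained\<close> below.\<close>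

definition running_max :: "(real \<Rightarrow> 'a \<Rightarrow> real) \<Rightarrow> real \<Rightarrow> 'a \<Rightarrow> real" where
  "running_max X t \<omega> = (SUP s\<in>{0..t}. X s \<omega>)"

definition cond_law :: "'a measure \<Rightarrow> ('a \<Rightarrow> real) \<Rightarrow> ('a \<Rightarrow> bool) \<Rightarrow> real measure" where
  "cond_law M X A = distr (uniform_measure M {\<omega> \<in> space M. A \<omega>}) borel X"

definition has_density_on :: "real measure \<Rightarrow> (real \<Rightarrow> real) \<Rightarrow> real set \<Rightarrow> bool" where
  "has_density_on \<mu> f I \<longleftrightarrow>
    restrict_space \<mu> I = density (restrict_space lborel I) (\<lambda>x. ennreal (f x))"

context poisson_process
begin

lemma switch_integrable:
  assumes "\<omega> \<in> space M"
  shows "(\<lambda>s. v * (-1) ^ N s \<omega> :: real) integrable_on {0..t}"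
proof -
  define g where "g = (\<lambda>s. real (N (max 0 s) \<omega>))"
  have "mono g"
    using N_mono[OF assms] by (auto simp: g_def mono_def mono_on_def)
  then have g: "g \<in> borel_measurable borel"
    by (rule borel_measurable_mono)
  have "(\<lambda>s. nat \<lfloor>g s\<rfloor>) \<in> measurable borel (count_space UNIV)"
    using g by measurable
  then have "(\<lambda>s. v * (-1) ^ nat \<lfloor>g s\<rfloor>) \<in> borel_measurable borel"
    by measurable
  then have m: "(\<lambda>s. v * (-1) ^ N (max 0 s) \<omega>) \<in> borel_measurable borel"
    by (simp add: g_def)
  have "(\<lambda>s. v * (-1) ^ N (max 0 s) \<omega>) integrable_on {0..t}"
  proof (rule measurable_bounded_by_integrable_imp_integrable_real)
    show "(\<lambda>s. v * (-1) ^ N (max 0 s) \<omega>) \<in> borel_measurable (lebesgue_on {0..t})"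
      using m by (metis borel_measurable_subalgebra measurable_completion
        measurable_lborel2 measurable_restrict_space1)
    show "(\<lambda>s. \<bar>v\<bar>) integrable_on {0..t}" by (rule integrable_const_ivl)
  qed (auto simp: abs_mult power_abs)
  then show ?thesis
    by (rule integrable_eq) auto
qed

end

lemma (in symmetric_telegraph) running_max_attained:
  assumes "\<omega> \<in> space M" and "0 \<le> t"
  shows "\<exists>s\<in>{0..t}. telegraph N V0 s \<omega> = running_max (telegraph N V0) t \<omega> \<and>
    (\<forall>u\<in>{0..t}. telegraph N V0 u \<omega> \<le> telegraph N V0 s \<omega>)"
proof -
  have "continuous_on {0..t} (\<lambda>s. telegraph N V0 s \<omega>)"
    unfolding telegraph_def
    by (rule indefinite_integral_continuous_1 switch_integrable assms)+
  then obtain s where s: "s \<in> {0..t}"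
    "\<forall>u\<in>{0..t}. telegraph N V0 u \<omega> \<le> telegraph N V0 s \<omega>"
    using continuous_attains_sup[of "{0..t}" "\<lambda>s. telegraph N V0 s \<omega>"] assms by auto
  then have "running_max (telegraph N V0) t \<omega> = telegraph N V0 s \<omega>"
    unfolding running_max_def by (intro cSup_eq_maximum) auto
  with s show ?thesis by auto
qed

end

theory Submission
  imports Defs
begin

text \<open>
  Discretise time with step \<open>t / m\<close>. On a path with \<open>n\<close> switches, replacing each switching time by
  the next grid point moves the maximum by at most a constant multiple of \<open>1 / m\<close>, and up to an event
  of vanishing probability every grid cell contains at most one switch. Given \<open>n\<close> switches, all
  0/1 sequences of cell counts are then equally likely, so the law of the maximum reduces to counting
  the lattice paths with \<open>n\<close> turns that stay below a barrier.

  In light-cone coordinates (\<open>A + B\<close> remaining steps, headroom \<open>B - A\<close>) each step lowers one of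
  \<open>A\<close>, \<open>B\<close> by one, and Pascal's rule solves the recursion in closed form: the number of paths that
  start downwards is \<open>\<Sum>i\<le>n. sgn (n + 1 - 2 * i) * (A choose i) * (B choose (n - i))\<close>. As \<open>m\<close> tends to
  infinity this becomes a signed binomial sum with success probability \<open>(c * t - x) / (2 * c * t)\<close>; for
  \<open>n = 2 * k\<close> its derivative in \<open>x\<close> telescopes to the density, and its value at \<open>x = 0\<close> is the atom.
\<close>

section \<open>Lattice paths below a barrier\<close>

text \<open>
  A list entry \<open>y\<close> is the number of switches in a cell: the walk first moves by \<open>\<sigma>\<close>, reducing the
  headroom \<open>d\<close>, and then turns if \<open>y\<close> is odd. It is killed when it points upwards at headroom \<open>0\<close>, even
  after the last step; with this convention, touching the barrier and turning at once is allowed, and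
  the count has the closed form of \<open>card_barrier_lists\<close> without boundary corrections.
\<close>

primrec below_barrier :: "int \<Rightarrow> int \<Rightarrow> nat list \<Rightarrow> bool" where
  "below_barrier \<sigma> d [] \<longleftrightarrow> \<not> (\<sigma> = 1 \<and> d = 0)"
| "below_barrier \<sigma> d (y # ys) \<longleftrightarrow>
     \<not> (\<sigma> = 1 \<and> d = 0) \<and> below_barrier (\<sigma> * (-1) ^ y) (d - \<sigma>) ys"

text \<open>Cell counts without multiple switches: by \<open>prob_grid_increments\<close> all lists
  of one such set have the same probability, so probabilities turn into cardinalities.\<close>

definition turn_lists :: "nat \<Rightarrow> nat \<Rightarrow> nat list set" where
  "turn_lists m n = {ys. length ys = m \<and> set ys \<subseteq> {0, 1} \<and> sum_list ys = n}"

definition barrier_lists :: "int \<Rightarrow> int \<Rightarrow> nat \<Rightarrow> nat \<Rightarrow> nat list set" where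
  "barrier_lists \<sigma> d m n = {ys \<in> turn_lists m n. below_barrier \<sigma> d ys}"

section \<open>Enumeration by the first cell\<close>

lemma finite_turn_lists: "finite (turn_lists m n)"
  by (rule finite_subset[OF _ finite_lists_length_eq[of "{0, 1}" m]]) (auto simp: turn_lists_def)

lemma finite_barrier_lists: "finite (barrier_lists \<sigma> d m n)"
  by (simp add: barrier_lists_def finite_turn_lists)

lemma turn_lists_0: "turn_lists 0 n = (if n = 0 then {[]} else {})"
  by (auto simp: turn_lists_def)

lemma turn_lists_Suc:
  "turn_lists (Suc m) n =
     (#) 0 ` turn_lists m n \<union> (if n = 0 then {} else (#) 1 ` turn_lists m (n - 1))"
proof (intro equalityI subsetI)
  fix zs assume "zs \<in> turn_lists (Suc m) n"
  then obtain y ys where "zs = y # ys" "length ys = m" "y \<in> {0, 1}" "set ys \<subseteq> {0, 1}"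
    "y + sum_list ys = n"
    by (cases zs) (auto simp: turn_lists_def)
  then show "zs \<in> (#) 0 ` turn_lists m n \<union> (if n = 0 then {} else (#) 1 ` turn_lists m (n - 1))"
    by (auto simp: turn_lists_def)
qed (auto simp: turn_lists_def split: if_splits)

lemma barrier_lists_Suc:
  assumes "\<not> (\<sigma> = 1 \<and> d = 0)"
  shows "barrier_lists \<sigma> d (Suc m) n =
     (#) 0 ` barrier_lists \<sigma> (d - \<sigma>) m n \<union>
     (if n = 0 then {} else (#) 1 ` barrier_lists (- \<sigma>) (d - \<sigma>) m (n - 1))"
  using assms by (auto simp: barrier_lists_def turn_lists_Suc)

lemma card_barrier_lists_Suc:
  assumes "\<not> (\<sigma> = 1 \<and> d = 0)"
  shows "card (barrier_lists \<sigma> d (Suc m) n) =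
     card (barrier_lists \<sigma> (d - \<sigma>) m n) +
     (if n = 0 then 0 else card (barrier_lists (- \<sigma>) (d - \<sigma>) m (n - 1)))"
  unfolding barrier_lists_Suc[OF assms]
  by (subst card_Un_disjoint) (auto simp: finite_barrier_lists card_image)

lemma card_turn_lists: "card (turn_lists m n) = m choose n"
proof (induction m arbitrary: n)
  case 0
  then show ?case by (simp add: turn_lists_0)
next
  case (Suc m)
  have "card (turn_lists (Suc m) n) =
    card (turn_lists m n) + (if n = 0 then 0 else card (turn_lists m (n - 1)))"
    unfolding turn_lists_Suc by (subst card_Un_disjoint) (auto simp: finite_turn_lists card_image)
  then show ?case
    by (cases n) (simp_all add: Suc.IH)
qed

lemma below_barrier_dead: "\<not> below_barrier 1 0 ys"
  by (cases ys) auto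

text \<open>One step lowers the headroom by at most one, so a headroom exceeding the number of steps
  never reaches 0.\<close>

lemma below_barrier_if_far: "\<bar>\<sigma>\<bar> = 1 \<Longrightarrow> int (length ys) < d \<Longrightarrow> below_barrier \<sigma> d ys"
proof (induction ys arbitrary: \<sigma> d)
  case (Cons y ys)
  have "below_barrier (\<sigma> * (-1) ^ y) (d - \<sigma>) ys"
    using Cons.prems by (intro Cons.IH) (auto simp: abs_mult power_abs)
  with Cons.prems show ?case by auto
qed auto

text \<open>Headroom equal to the number of steps suffices here, because the first step goes down
  and leaves a surplus. This is the base case \<open>A = 0\<close> of the closed form.\<close>

lemma barrier_lists_down_far: "barrier_lists (-1) (int m) m n = turn_lists m n"
proof -
  have "below_barrier (-1) (int (length ys)) ys" for ys
    by (cases ys) (auto intro!: below_barrier_if_far simp: power_abs)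
  then show ?thesis
    by (auto simp: barrier_lists_def turn_lists_def)
qed

text \<open>The parameter \<open>e\<close> is \<open>1\<close> for paths that start downwards and \<open>0\<close> for those that start upwards.\<close>

definition signed_choose :: "int \<Rightarrow> nat \<Rightarrow> nat \<Rightarrow> nat \<Rightarrow> int" where
  "signed_choose e n A B =
     (\<Sum>i\<le>n. sgn (int n + e - 2 * int i) * int (A choose i) * int (B choose (n - i)))"

section \<open>Pascal recursions for the signed sum\<close>

text \<open>The value 0 for \<open>e = 0\<close> fits the killing rule: an upward path without turns
  has headroom \<open>B - A\<close>, at most its \<open>A + B\<close> steps, so it ends up pointing
  upwards at headroom 0.\<close>

lemma signed_choose_0: "signed_choose e 0 A B = sgn e"
  by (simp add: signed_choose_def)

lemma signed_choose_no_A: "signed_choose e n 0 B = sgn (int n + e) * int (B choose n)"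
proof -
  have "signed_choose e n 0 B = (\<Sum>i\<in>{0}. sgn (int n + e - 2 * int i) * int (0 choose i) * int (B choose (n - i)))"
    unfolding signed_choose_def by (intro sum.mono_neutral_right) (auto simp: binomial_eq_0)
  then show ?thesis by simp
qed

text \<open>Pascal's rule in \<open>A\<close> leaves \<open>A choose (i - 1)\<close>. Shifting the
  index by one subtracts 2 inside the sign, while \<open>n\<close> drops by 1, so \<open>e\<close>
  falls from 1 to 0: the path turned upwards.\<close>

lemma signed_choose_Suc_A:
  "signed_choose 1 (Suc n) (Suc A) B = signed_choose 1 (Suc n) A B + signed_choose 0 n A B"
proof -
  have "signed_choose 1 (Suc n) (Suc A) B - signed_choose 1 (Suc n) A B =
    (\<Sum>i\<le>Suc n. sgn (int (Suc n) + 1 - 2 * int i) *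
       (int (Suc A choose i) - int (A choose i)) * int (B choose (Suc n - i)))"
    by (simp only: signed_choose_def sum_subtractf[symmetric] left_diff_distrib right_diff_distrib)
  also have "\<dots> = signed_choose 0 n A B"
    unfolding signed_choose_def by (subst sum.atMost_Suc_shift) simp
  finally show ?thesis by simp
qed

text \<open>Pascal's rule acts on the second factor, so the index is not shifted; the lost unit of
  \<open>n\<close> reappears as \<open>e = 1\<close>. The term \<open>i = Suc n\<close> vanishes
  since both binomials equal 1.\<close>

lemma signed_choose_Suc_B:
  "signed_choose 0 (Suc n) A (Suc B) = signed_choose 0 (Suc n) A B + signed_choose 1 n A B"
proof -
  have "signed_choose 0 (Suc n) A (Suc B) - signed_choose 0 (Suc n) A B =
    (\<Sum>i\<le>Suc n. sgn (int (Suc n) - 2 * int i) *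
       int (A choose i) * (int (Suc B choose (Suc n - i)) - int (B choose (Suc n - i))))"
    by (simp only: signed_choose_def sum_subtractf[symmetric] left_diff_distrib right_diff_distrib add_0_right)
  also have "\<dots> = signed_choose 1 n A B"
    unfolding signed_choose_def by (auto simp: Suc_diff_le ac_simps intro!: sum.cong)
  finally show ?thesis by simp
qed

text \<open>The reflection \<open>i\<close> to \<open>n - i\<close> swaps the two equal binomials
  and flips the sign, so the sum is its own negative. It matches the immediate killing of an upward
  path at headroom 0.\<close>

lemma signed_choose_diagonal: "signed_choose 0 n A A = 0"
proof -
  have "signed_choose 0 n A A =
    (\<Sum>i\<le>n. sgn (int n - 2 * int (n - i)) * int (A choose (n - i)) * int (A choose (n - (n - i))))"
    unfolding signed_choose_def atMost_atLeast0 by (subst sum.atLeastAtMost_rev) simp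
  also have "\<dots> = (\<Sum>i\<le>n. - (sgn (int n - 2 * int i) * int (A choose i) * int (A choose (n - i))))"
  proof (rule sum.cong)
    fix i assume "i \<in> {..n}"
    then have "int n - 2 * int (n - i) = - (int n - 2 * int i)" by simp
    then have "sgn (int n - 2 * int (n - i)) = - sgn (int n - 2 * int i)" by (simp only: idom_abs_sgn_class.sgn_minus)
    then show "sgn (int n - 2 * int (n - i)) * int (A choose (n - i)) * int (A choose (n - (n - i))) =
      - (sgn (int n - 2 * int i) * int (A choose i) * int (A choose (n - i)))"
      using \<open>i \<in> {..n}\<close> by simp
  qed simp
  also have "\<dots> = - signed_choose 0 n A A"
    by (simp add: signed_choose_def sum_negf)
  finally show ?thesis by simp
qed

text \<open>A step down replaces \<open>A\<close> by \<open>A - 1\<close> and a step up replaces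
  \<open>B\<close> by \<open>B - 1\<close>; \<open>A + B\<close> counts the remaining steps and
  \<open>B - A\<close> is the headroom. A turn exchanges the two directions, so both counts are
  proved together. The recursion stops at \<open>A = 0\<close> for downward starts and at
  \<open>A = B\<close> for upward ones.\<close>

lemma card_barrier_lists:
  "A \<le> B \<Longrightarrow>
    int (card (barrier_lists (-1) (int B - int A) (A + B) n)) = signed_choose 1 n A B \<and>
    int (card (barrier_lists 1 (int B - int A) (A + B) n)) = signed_choose 0 n A B"
proof (induction "A + B" arbitrary: A B n rule: less_induct)
  case less
  have down: "int (card (barrier_lists (-1) (int B - int A) (A + B) n)) = signed_choose 1 n A B"
  proof (cases A)
    case 0
    then show ?thesis
      using barrier_lists_down_far[of B n] by (simp add: signed_choose_no_A card_turn_lists)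
  next
    case (Suc A')
    have IH: "int (card (barrier_lists (-1) (int B - int A') (A' + B) i)) = signed_choose 1 i A' B"
      "int (card (barrier_lists 1 (int B - int A') (A' + B) i)) = signed_choose 0 i A' B" for i
      using less.hyps[of A' B i] less.prems Suc by simp_all
    have d: "int B - int A - (-1) = int B - int A'" and m: "A + B = Suc (A' + B)"
      using Suc by simp_all
    show ?thesis
      unfolding m by (subst card_barrier_lists_Suc)
        (simp, cases n, simp_all only: d IH of_nat_add Suc signed_choose_Suc_A signed_choose_0 minus_minus, simp_all add: IH signed_choose_0)
  qed
  have up: "int (card (barrier_lists 1 (int B - int A) (A + B) n)) = signed_choose 0 n A B"
  proof (cases "A = B")
    case True
    then have "barrier_lists 1 (int B - int A) (A + B) n = {}"
      using below_barrier_dead by (auto simp: barrier_lists_def)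
    then show ?thesis using True by (simp add: signed_choose_diagonal)
  next
    case False
    then obtain B' where B: "B = Suc B'" "A \<le> B'" using less.prems by (cases B) auto
    have IH: "int (card (barrier_lists (-1) (int B' - int A) (A + B') i)) = signed_choose 1 i A B'"
      "int (card (barrier_lists 1 (int B' - int A) (A + B') i)) = signed_choose 0 i A B'" for i
      using less.hyps[of A B' i] B by simp_all
    have d: "int B - int A - 1 = int B' - int A" and m: "A + B = Suc (A + B')"
      using B by simp_all
    show ?thesis
      unfolding m using B(2) by (subst card_barrier_lists_Suc)
        (simp add: B(1), cases n, simp_all only: d IH of_nat_add B(1) signed_choose_Suc_B signed_choose_0, simp_all add: IH signed_choose_0)
  qed
  from down up show ?case ..
qed

section \<open>Survival in terms of displacements\<close>

text \<open>The killing rule keeps the headroom nonnegative. Only a weak bound can hold, since a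
  surviving walk may touch the barrier and turn at once; conversely
  \<open>below_barrier_if_less\<close> asks for a strict bound. The gap of one grid unit disappears
  in the limit.\<close>

lemma below_barrier_imp_le:
  assumes "\<bar>\<sigma>\<bar> = 1" "0 \<le> d" "below_barrier \<sigma> d ys" "j \<le> length ys"
  shows "\<sigma> * (\<Sum>i<j. (-1) ^ sum_list (take i ys)) \<le> d"
  using assms
proof (induction ys arbitrary: \<sigma> d j)
  case (Cons y ys)
  show ?case
  proof (cases j)
    case (Suc j')
    have "\<sigma> * (-1) ^ y * (\<Sum>i<j'. (-1) ^ sum_list (take i ys)) \<le> d - \<sigma>"
    proof (rule Cons.IH)
      show "0 \<le> d - \<sigma>" using Cons.prems(1-3) by (cases "d = 0") (auto simp: abs_if split: if_splits)
    qed (use Cons.prems Suc in \<open>auto simp: abs_mult power_abs\<close>)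
    then show ?thesis
      unfolding Suc sum.lessThan_Suc_shift
      by (simp add: power_add sum_distrib_left algebra_simps)
  qed (use Cons.prems in simp)
qed simp

lemma below_barrier_if_less:
  assumes "\<bar>\<sigma>\<bar> = 1" "\<And>j. j \<le> length ys \<Longrightarrow> \<sigma> * (\<Sum>i<j. (-1) ^ sum_list (take i ys)) < d"
  shows "below_barrier \<sigma> d ys"
  using assms
proof (induction ys arbitrary: \<sigma> d)
  case Nil
  from Nil(2)[of 0] show ?case by simp
next
  case (Cons y ys)
  have "below_barrier (\<sigma> * (-1) ^ y) (d - \<sigma>) ys"
  proof (rule Cons.IH)
    fix j assume "j \<le> length ys"
    then show "\<sigma> * (-1) ^ y * (\<Sum>i<j. (-1) ^ sum_list (take i ys)) < d - \<sigma>"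
      using Cons.prems(2)[of "Suc j"]
      unfolding sum.lessThan_Suc_shift
      by (simp add: power_add sum_distrib_left algebra_simps)
  qed (use Cons.prems in \<open>simp add: abs_mult power_abs\<close>)
  with Cons.prems(2)[of 0] show ?case by simp
qed

section \<open>The signed binomial sum\<close>

lemma eventually_le_mult_real:
  fixes a K :: real
  assumes "0 < a"
  shows "\<forall>\<^sub>F m in sequentially. K \<le> a * real m"
proof (rule eventually_sequentiallyI[of "nat \<lceil>K / a\<rceil>"])
  fix m assume "nat \<lceil>K / a\<rceil> \<le> m"
  then have "K / a \<le> real m" by linarith
  then show "K \<le> a * real m" using assms by (simp add: field_simps)
qed

section \<open>Limits of binomial coefficients and of the signed sum\<close>

lemma tendsto_if_bounded_deviation:
  fixes A :: "nat \<Rightarrow> nat"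
  assumes "\<forall>\<^sub>F m in sequentially. \<bar>real (A m) - p * real m\<bar> \<le> C"
  shows "(\<lambda>m. real (A m) / real m) \<longlonglongrightarrow> p"
proof -
  have "(\<lambda>m. real (A m) / real m - p) \<longlonglongrightarrow> 0"
  proof (rule Lim_null_comparison)
    show "\<forall>\<^sub>F m in sequentially. norm (real (A m) / real m - p) \<le> C / real m"
      using assms eventually_gt_at_top[of 0]
    proof eventually_elim
      case (elim m)
      then have "real (A m) / real m - p = (real (A m) - p * real m) / real m"
        by (simp add: field_simps)
      with elim show ?case by (simp add: divide_right_mono)
    qed
    show "(\<lambda>m. C / real m) \<longlonglongrightarrow> 0" by (rule lim_const_over_n)
  qed
  then show ?thesis by (rule LIM_zero_cancel)
qed

text \<open>The falling factorial has \<open>i\<close> factors, each of which tends to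
  \<open>p\<close> after division by \<open>m\<close>.\<close>

lemma tendsto_binomial_ratio:
  fixes A :: "nat \<Rightarrow> nat"
  assumes "(\<lambda>m. real (A m) / real m) \<longlonglongrightarrow> p"
  shows "(\<lambda>m. real (A m choose i) / real m ^ i) \<longlonglongrightarrow> p ^ i / fact i"
proof -
  have "(\<lambda>m. (\<Prod>l<i. real (A m) / real m - real l / real m) / fact i) \<longlonglongrightarrow> (\<Prod>l<i. p - 0) / fact i"
    by (intro tendsto_divide tendsto_prod tendsto_diff assms lim_const_over_n) auto
  moreover have "(\<Prod>l<i. real (A m) / real m - real l / real m) / fact i =
      real (A m choose i) / real m ^ i" for m
  proof -
    have "real (A m choose i) = (\<Prod>l<i. real (A m) - real l) / fact i"
      by (simp add: binomial_gbinomial gbinomial_prod_rev atLeast0LessThan)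
    then show ?thesis
      by (simp add: diff_divide_distrib[symmetric] prod_dividef)
  qed
  ultimately show ?thesis by simp
qed

text \<open>For \<open>X\<close> binomial with parameters \<open>n\<close> and \<open>p\<close> this
  is P(2X < n + 1) - P(2X > n + 1).\<close>

definition signed_binomial :: "nat \<Rightarrow> real \<Rightarrow> real" where
  "signed_binomial n p =
     (\<Sum>i\<le>n. sgn (real n + 1 - 2 * real i) * real (n choose i) * p ^ i * (1 - p) ^ (n - i))"

text \<open>Termwise limit: \<open>m ^ n\<close> splits into \<open>m ^ i * m ^ (n - i)\<close>, and
  the two factorials combine to \<open>n choose i\<close> over \<open>fact n\<close>.\<close>

lemma tendsto_signed_choose:
  fixes A B :: "nat \<Rightarrow> nat"
  assumes "(\<lambda>m. real (A m) / real m) \<longlonglongrightarrow> p" "(\<lambda>m. real (B m) / real m) \<longlonglongrightarrow> 1 - p"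
  shows "(\<lambda>m. real_of_int (signed_choose 1 n (A m) (B m)) / real m ^ n) \<longlonglongrightarrow>
    signed_binomial n p / fact n"
proof -
  have "(\<lambda>m. \<Sum>i\<le>n. sgn (real n + 1 - 2 * real i) *
        (real (A m choose i) / real m ^ i) * (real (B m choose (n - i)) / real m ^ (n - i)))
      \<longlonglongrightarrow> (\<Sum>i\<le>n. sgn (real n + 1 - 2 * real i) *
        (p ^ i / fact i) * ((1 - p) ^ (n - i) / fact (n - i)))"
    by (intro tendsto_intros tendsto_binomial_ratio assms)
  also have "(\<lambda>m. \<Sum>i\<le>n. sgn (real n + 1 - 2 * real i) *
        (real (A m choose i) / real m ^ i) * (real (B m choose (n - i)) / real m ^ (n - i))) =
      (\<lambda>m. real_of_int (signed_choose 1 n (A m) (B m)) / real m ^ n)"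
  proof
    fix m
    have "sgn (real n + 1 - 2 * real i) * (real (A m choose i) / real m ^ i) *
          (real (B m choose (n - i)) / real m ^ (n - i)) =
        real_of_int (sgn (int n + 1 - 2 * int i) * int (A m choose i) * int (B m choose (n - i)))
          / real m ^ n" if "i \<le> n" for i
    proof -
      have "real m ^ n = real m ^ i * real m ^ (n - i)"
        using that by (simp flip: power_add)
      moreover have "sgn (real n + 1 - 2 * real i) = real_of_int (sgn (int n + 1 - 2 * int i))"
        by (auto simp: sgn_if)
      ultimately show ?thesis by simp
    qed
    then show "(\<Sum>i\<le>n. sgn (real n + 1 - 2 * real i) *
        (real (A m choose i) / real m ^ i) * (real (B m choose (n - i)) / real m ^ (n - i))) =
      real_of_int (signed_choose 1 n (A m) (B m)) / real m ^ n"
      by (simp add: signed_choose_def sum_divide_distrib)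
  qed
  also have "(\<Sum>i\<le>n. sgn (real n + 1 - 2 * real i) *
        (p ^ i / fact i) * ((1 - p) ^ (n - i) / fact (n - i))) = signed_binomial n p / fact n"
    unfolding signed_binomial_def sum_divide_distrib
    by (intro sum.cong) (simp_all add: binomial_fact)
  finally show ?thesis .
qed

section \<open>Even number of switches: value and derivative\<close>

text \<open>The odd number \<open>2 * k + 1 - 2 * i\<close> is never 0, so the signs are 1 up to
  \<open>k\<close> and -1 beyond. As all terms without signs sum to 1, the value is twice the lower
  part minus 1.\<close>

lemma signed_binomial_even:
  "signed_binomial (2 * k) p =
     2 * (\<Sum>i\<le>k. real (2 * k choose i) * p ^ i * (1 - p) ^ (2 * k - i)) - 1"
proof -
  define w where "w i = real (2 * k choose i) * p ^ i * (1 - p) ^ (2 * k - i)" for i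
  have split: "(\<Sum>i\<le>2 * k. g i) = (\<Sum>i\<le>k. g i) + (\<Sum>i\<in>{Suc k..2 * k}. g i)" for g :: "nat \<Rightarrow> real"
    by (subst sum.union_disjoint[symmetric]) (auto intro!: sum.cong)
  have "1 = (\<Sum>i\<le>2 * k. w i)"
    using binomial_ring[of p "1 - p" "2 * k"] by (simp add: w_def)
  moreover have "signed_binomial (2 * k) p = (\<Sum>i\<le>2 * k. sgn (2 * real k + 1 - 2 * real i) * w i)"
    by (simp add: signed_binomial_def w_def mult.assoc)
  moreover have "(\<Sum>i\<le>k. sgn (2 * real k + 1 - 2 * real i) * w i) = (\<Sum>i\<le>k. w i)"
    by (intro sum.cong) (auto simp: sgn_if)
  moreover have "(\<Sum>i\<in>{Suc k..2 * k}. sgn (2 * real k + 1 - 2 * real i) * w i) = (\<Sum>i\<in>{Suc k..2 * k}. - w i)"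
    by (intro sum.cong) (auto simp: sgn_if)
  ultimately show ?thesis
    unfolding w_def[symmetric] by (simp add: split sum_negf)
qed

text \<open>At \<open>p = 1 / 2\<close> all weights agree. By the symmetry \<open>i\<close> to
  \<open>2 * k - i\<close>, twice the lower half of the row is the full row plus the central
  coefficient, which belongs to both halves.\<close>

lemma signed_binomial_half: "signed_binomial (2 * k) (1 / 2) = real (2 * k choose k) / 2 ^ (2 * k)"
proof -
  define w where "w i = real (2 * k choose i)" for i
  have w: "(1/2) ^ i * (1 - 1/2) ^ (2 * k - i) = (1/2 :: real) ^ (2 * k)" if "i \<le> 2 * k" for i
    using that by (simp flip: power_add)
  have "(\<Sum>i\<le>2 * k. w i) = (\<Sum>i\<le>k. w i) + (\<Sum>i\<in>{k..2 * k}. w i) - w k"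
  proof -
    have "{..2 * k} = {..k} \<union> {Suc k..2 * k}" by auto
    then have "(\<Sum>i\<le>2 * k. w i) = (\<Sum>i\<le>k. w i) + (\<Sum>i\<in>{Suc k..2 * k}. w i)"
      by (simp add: sum.union_disjoint)
    also have "(\<Sum>i\<in>{k..2 * k}. w i) = w k + (\<Sum>i\<in>{Suc k..2 * k}. w i)"
      by (subst sum.atLeast_Suc_atMost) auto
    ultimately show ?thesis by simp
  qed
  also have "(\<Sum>i\<in>{k..2 * k}. w i) = (\<Sum>i\<le>k. w i)"
    by (rule sum.reindex_bij_witness[of _ "\<lambda>i. 2 * k - i" "\<lambda>i. 2 * k - i"])
       (auto simp: w_def binomial_symmetric[symmetric])
  finally have "2 * (\<Sum>i\<le>k. w i) = (\<Sum>i\<le>2 * k. w i) + w k" by simp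
  also have "(\<Sum>i\<le>2 * k. w i) = 2 ^ (2 * k)"
    unfolding w_def using choose_row_sum[of "2 * k"] by (metis of_nat_sum of_nat_power of_nat_numeral)
  finally have sum_w: "2 * (\<Sum>i\<le>k. w i) = 2 ^ (2 * k) + w k" .
  have "signed_binomial (2 * k) (1 / 2) = 2 * (\<Sum>i\<le>k. w i * (1/2) ^ (2 * k)) - 1"
  proof -
    have "real (2 * k choose i) * (1/2) ^ i * (1 - 1/2) ^ (2 * k - i) = w i * (1/2) ^ (2 * k)"
      if "i \<le> k" for i
      using w[of i] that by (simp only: mult.assoc w_def)
    then have "(\<Sum>i\<le>k. real (2 * k choose i) * (1/2) ^ i * (1 - 1/2) ^ (2 * k - i)) =
        (\<Sum>i\<le>k. w i * (1/2) ^ (2 * k))"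
      by (intro sum.cong refl) (simp only: atMost_iff)
    then show ?thesis
      unfolding signed_binomial_even by (simp only:)
  qed
  also have "\<dots> = (2 * (\<Sum>i\<le>k. w i)) * (1/2) ^ (2 * k) - 1"
    by (simp add: sum_distrib_right)
  also have "\<dots> = w k / 2 ^ (2 * k)"
    unfolding sum_w by (simp add: field_simps power_one_over)
  finally show ?thesis by (simp add: w_def)
qed

text \<open>The derivative of each term is a difference of two consecutive expressions of the same
  shape, so the sum telescopes to its last boundary term.\<close>

lemma DERIV_binomial_tail:
  assumes "k < n"
  shows "((\<lambda>p :: real. \<Sum>i\<le>k. real (n choose i) * p ^ i * (1 - p) ^ (n - i)) has_real_derivative
    - (real (n - k) * real (n choose k) * p ^ k * (1 - p) ^ (n - k - 1))) (at p)"
  using assms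
proof (induction k)
  case 0
  show ?case by (auto intro!: derivative_eq_intros)
next
  case (Suc k)
  \<comment> \<open>This identity makes the positive half of the new derivative cancel the boundary
    term of the induction hypothesis.\<close>
  have absorb: "real (Suc k) * real (n choose Suc k) = real (n - k) * real (n choose k)"
    using binomial_absorb_comp[of n k] Suc_times_binomial_eq
    by (metis (no_types, lifting) of_nat_mult binomial_absorption mult.commute)
  obtain r where r: "n = Suc (Suc (k + r))"
    using Suc.prems less_iff_Suc_add by auto
  have "((\<lambda>p :: real. p ^ Suc k) has_real_derivative real (Suc k) * p ^ k) (at p)"
    using DERIV_pow[of "Suc k" p] by simp
  moreover have "((\<lambda>p :: real. (1 - p) ^ Suc r) has_real_derivative - (real (Suc r) * (1 - p) ^ r)) (at p)"
  proof -
    have "((\<lambda>p :: real. 1 - p) has_real_derivative -1) (at p)"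
      by (auto intro!: derivative_eq_intros)
    from DERIV_power[OF this, of "Suc r"] show ?thesis by simp
  qed
  ultimately have "((\<lambda>p :: real. real (n choose Suc k) * (p ^ Suc k * (1 - p) ^ Suc r)) has_real_derivative
      real (n choose Suc k) * (real (Suc k) * p ^ k * (1 - p) ^ Suc r
        + - (real (Suc r) * (1 - p) ^ r) * p ^ Suc k)) (at p)"
    by (intro DERIV_cmult DERIV_mult)
  moreover have "real (n choose Suc k) * (real (Suc k) * p ^ k * (1 - p) ^ Suc r
        + - (real (Suc r) * (1 - p) ^ r) * p ^ Suc k) =
      real (Suc k) * real (n choose Suc k) * p ^ k * (1 - p) ^ Suc r
      - real (Suc r) * real (n choose Suc k) * p ^ Suc k * (1 - p) ^ r"
    by (simp only: ring_distribs mult_minus_left mult_minus_right diff_conv_add_uminus ac_simps)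
  ultimately have "((\<lambda>p :: real. real (n choose Suc k) * (p ^ Suc k * (1 - p) ^ Suc r)) has_real_derivative
      real (n - k) * real (n choose k) * p ^ k * (1 - p) ^ Suc r
      - real (Suc r) * real (n choose Suc k) * p ^ Suc k * (1 - p) ^ r) (at p)"
    unfolding absorb by simp
  from DERIV_add[OF Suc.IH this] Suc.prems show ?case
    by (simp only: sum.atMost_Suc r mult.assoc) (simp add: r mult.assoc)
qed

lemma DERIV_signed_binomial_even:
  assumes "k \<ge> 1"
  shows "(signed_binomial (2 * k) has_real_derivative
    - (2 * real k * real (2 * k choose k) * p ^ k * (1 - p) ^ (k - 1))) (at p)"
proof -
  have "signed_binomial (2 * k) = (\<lambda>p. 2 * (\<Sum>i\<le>k. real (2 * k choose i) * p ^ i * (1 - p) ^ (2 * k - i)) - 1)"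
    by (rule ext) (rule signed_binomial_even)
  then show ?thesis
    using DERIV_diff[OF DERIV_cmult[OF DERIV_binomial_tail[of k "2 * k" p], of 2] DERIV_const[of 1]] assms
    by (simp add: mult.assoc)
qed

section \<open>Grid approximation of the telegraph process\<close>

text \<open>Each cell uses the direction at its left end. The walk always starts with +1; the
  initial velocity enters only through the factor \<open>V0 \<omega> * h\<close>.\<close>

definition grid_walk :: "(real \<Rightarrow> 'a \<Rightarrow> nat) \<Rightarrow> real \<Rightarrow> nat \<Rightarrow> 'a \<Rightarrow> int" where
  "grid_walk N h j \<omega> = (\<Sum>i<j. (-1) ^ N (real i * h) \<omega>)"

text \<open>The subtraction of natural numbers is exact on paths of the process, because they are
  monotone.\<close>

definition grid_increments :: "(real \<Rightarrow> 'a \<Rightarrow> nat) \<Rightarrow> real \<Rightarrow> nat \<Rightarrow> 'a \<Rightarrow> nat list" where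
  "grid_increments N h m \<omega> = map (\<lambda>i. N (real (Suc i) * h) \<omega> - N (real i * h) \<omega>) [0..<m]"

lemma abs_alternating_diff_le:
  assumes "a \<le> b"
  shows "\<bar>(-1) ^ b - (-1) ^ a :: real\<bar> \<le> 2 * (real b - real a)"
  using assms by (cases "a = b") (auto simp: uminus_power_if)

context symmetric_telegraph
begin

lemma N_le: "\<omega> \<in> space M \<Longrightarrow> 0 \<le> s \<Longrightarrow> s \<le> u \<Longrightarrow> N s \<omega> \<le> N u \<omega>"
  using N_mono by (auto simp: mono_on_def)

lemma velocity_integrable:
  assumes "\<omega> \<in> space M" "0 \<le> a"
  shows "(\<lambda>s. v * (-1) ^ N s \<omega> :: real) integrable_on {a..b}"
  by (rule integrable_on_subinterval[OF switch_integrable[OF assms(1), of v b]]) (use assms in auto)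

lemma telegraph_diff:
  assumes "\<omega> \<in> space M" "0 \<le> a" "a \<le> b"
  shows "telegraph N V0 b \<omega> - telegraph N V0 a \<omega> = integral {a..b} (\<lambda>s. V0 \<omega> * (-1) ^ N s \<omega>)"
  using Henstock_Kurzweil_Integration.integral_combine[OF assms(2,3) velocity_integrable[OF assms(1), of 0 "V0 \<omega>"]]
  by (simp add: telegraph_def)

lemma telegraph_lipschitz:
  assumes "\<omega> \<in> space M" "0 \<le> a" "a \<le> b"
  shows "\<bar>telegraph N V0 b \<omega> - telegraph N V0 a \<omega>\<bar> \<le> \<bar>V0 \<omega>\<bar> * (b - a)"
proof -
  have "norm (integral {a..b} (\<lambda>s. V0 \<omega> * (-1) ^ N s \<omega>)) \<le> \<bar>V0 \<omega>\<bar> * measure lborel {a..b}"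
    by (rule has_integral_bound_real[OF _ finite.emptyI integrable_integral[OF velocity_integrable]])
       (use assms in \<open>auto simp: abs_mult power_abs\<close>)
  then show ?thesis using assms by (simp add: telegraph_diff)
qed

text \<open>Freezing the direction at \<open>a\<close> changes the velocity by at most
  \<open>2 * \<bar>V0 \<omega>\<bar>\<close>, and not at all without a switch. Stating the error as
  a multiple of the increment of \<open>N\<close> lets the errors of successive cells
  telescope.\<close>

lemma telegraph_step:
  assumes "\<omega> \<in> space M" "0 \<le> a" "a \<le> b"
  shows "\<bar>telegraph N V0 b \<omega> - telegraph N V0 a \<omega> - V0 \<omega> * (b - a) * (-1) ^ N a \<omega>\<bar>
    \<le> 2 * \<bar>V0 \<omega>\<bar> * (real (N b \<omega>) - real (N a \<omega>)) * (b - a)"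
proof -
  let ?f = "\<lambda>s. V0 \<omega> * (-1) ^ N s \<omega> - V0 \<omega> * (-1) ^ N a \<omega>"
  have int: "?f integrable_on {a..b}"
    by (intro integrable_diff velocity_integrable integrable_const_ivl assms)
  have "norm (integral {a..b} ?f) \<le> 2 * \<bar>V0 \<omega>\<bar> * (real (N b \<omega>) - real (N a \<omega>)) * measure lborel {a..b}"
  proof (rule has_integral_bound_real[OF _ finite.emptyI integrable_integral[OF int]])
    show "0 \<le> 2 * \<bar>V0 \<omega>\<bar> * (real (N b \<omega>) - real (N a \<omega>))"
      using N_le[OF assms] by simp
    fix s assume "s \<in> {a..b} - {}"
    then have le: "N a \<omega> \<le> N s \<omega>" "N s \<omega> \<le> N b \<omega>"
      using assms by (auto intro: N_le)
    have "norm (?f s) = \<bar>V0 \<omega>\<bar> * \<bar>(-1) ^ N s \<omega> - (-1) ^ N a \<omega>\<bar>"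
      by (simp add: abs_mult flip: right_diff_distrib)
    also have "\<dots> \<le> \<bar>V0 \<omega>\<bar> * (2 * (real (N b \<omega>) - real (N a \<omega>)))"
      using abs_alternating_diff_le[OF le(1)] le(2) by (intro mult_left_mono) auto
    finally show "norm (?f s) \<le> 2 * \<bar>V0 \<omega>\<bar> * (real (N b \<omega>) - real (N a \<omega>))"
      by (simp add: ac_simps)
  qed
  moreover have "integral {a..b} ?f = integral {a..b} (\<lambda>s. V0 \<omega> * (-1) ^ N s \<omega>)
      - integral {a..b} (\<lambda>s. V0 \<omega> * (-1) ^ N a \<omega>)"
    by (intro integral_diff velocity_integrable integrable_const_ivl assms)
  ultimately show ?thesis
    using assms by (simp add: telegraph_diff ac_simps)
qed

text \<open>The cell errors add up to a multiple of \<open>N (real j * h) \<omega>\<close>: only the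
  number of switches matters, not the number of cells.\<close>

lemma telegraph_grid:
  assumes "\<omega> \<in> space M" "0 \<le> h"
  shows "\<bar>telegraph N V0 (real j * h) \<omega> - V0 \<omega> * h * real_of_int (grid_walk N h j \<omega>)\<bar>
    \<le> 2 * real (N (real j * h) \<omega>) * (\<bar>V0 \<omega>\<bar> * h)"
proof (induction j)
  case 0
  show ?case using assms by (simp add: telegraph_def grid_walk_def)
next
  case (Suc j)
  have "real j * h \<le> real (Suc j) * h" "real (Suc j) * h - real j * h = h"
    using assms by (auto simp: algebra_simps)
  with telegraph_step[OF assms(1), of "real j * h" "real (Suc j) * h"] assms
  have step: "\<bar>telegraph N V0 (real (Suc j) * h) \<omega> - telegraph N V0 (real j * h) \<omega>
      - V0 \<omega> * h * (-1) ^ N (real j * h) \<omega>\<bar>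
    \<le> 2 * \<bar>V0 \<omega>\<bar> * (real (N (real (Suc j) * h) \<omega>) - real (N (real j * h) \<omega>)) * h"
    by (simp only: mult_nonneg_nonneg of_nat_0_le_iff)
  have rhs: "2 * \<bar>V0 \<omega>\<bar> * (real (N (real (Suc j) * h) \<omega>) - real (N (real j * h) \<omega>)) * h =
    2 * real (N (real (Suc j) * h) \<omega>) * (\<bar>V0 \<omega>\<bar> * h) - 2 * real (N (real j * h) \<omega>) * (\<bar>V0 \<omega>\<bar> * h)"
    by (simp only: ring_distribs ac_simps)
  have walk: "V0 \<omega> * h * real_of_int (grid_walk N h (Suc j) \<omega>) =
    V0 \<omega> * h * real_of_int (grid_walk N h j \<omega>) + V0 \<omega> * h * (-1) ^ N (real j * h) \<omega>"
    by (simp add: grid_walk_def ring_distribs)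
  show ?case
    using Suc.IH step unfolding rhs walk by linarith
qed

section \<open>Comparison of the maximum with its grid version\<close>

lemma telegraph_le_running_max:
  assumes "\<omega> \<in> space M" "0 \<le> s" "s \<le> t"
  shows "telegraph N V0 s \<omega> \<le> running_max (telegraph N V0) t \<omega>"
  using running_max_attained[of \<omega> t] assms by auto

lemma running_max_nonneg: "\<omega> \<in> space M \<Longrightarrow> 0 \<le> t \<Longrightarrow> 0 \<le> running_max (telegraph N V0) t \<omega>"
  using telegraph_le_running_max[of \<omega> 0 t] by (simp add: telegraph_def)

lemma grid_le_running_max:
  assumes "\<omega> \<in> space M" "0 \<le> h" "j \<le> m"
  shows "V0 \<omega> * h * real_of_int (grid_walk N h j \<omega>)
    \<le> running_max (telegraph N V0) (real m * h) \<omega> + (2 * real (N (real m * h) \<omega>) + 1) * (\<bar>V0 \<omega>\<bar> * h)"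
proof -
  have jm: "real j * h \<le> real m * h"
    using assms by (simp add: mult_right_mono)
  have "2 * real (N (real j * h) \<omega>) * (\<bar>V0 \<omega>\<bar> * h) \<le> 2 * real (N (real m * h) \<omega>) * (\<bar>V0 \<omega>\<bar> * h)"
    using N_le[OF assms(1) _ jm] assms by (intro mult_right_mono mult_left_mono) auto
  moreover have "0 \<le> \<bar>V0 \<omega>\<bar> * h" using assms by simp
  moreover have "telegraph N V0 (real j * h) \<omega> \<le> running_max (telegraph N V0) (real m * h) \<omega>"
    using assms jm by (intro telegraph_le_running_max) auto
  ultimately show ?thesis
    using telegraph_grid[OF assms(1,2), of j] unfolding ring_distribs by linarith
qed

text \<open>A maximising time is rounded down to the grid. The Lipschitz bound charges one extra
  \<open>\<bar>V0 \<omega>\<bar> * h\<close> for this, which is the \<open>+ 1\<close> in the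
  constant.\<close>

lemma running_max_le_grid:
  assumes "\<omega> \<in> space M" "0 < h"
  shows "\<exists>j\<le>m. running_max (telegraph N V0) (real m * h) \<omega>
    \<le> V0 \<omega> * h * real_of_int (grid_walk N h j \<omega>) + (2 * real (N (real m * h) \<omega>) + 1) * (\<bar>V0 \<omega>\<bar> * h)"
proof -
  have "0 \<le> real m * h" using assms by simp
  then obtain s where s: "s \<in> {0..real m * h}"
    "telegraph N V0 s \<omega> = running_max (telegraph N V0) (real m * h) \<omega>"
    using running_max_attained[OF assms(1)] by blast
  define j where "j = nat \<lfloor>s / h\<rfloor>"
  have j: "real j \<le> s / h" "s / h < real j + 1"
    using s assms by (auto simp: j_def)
  then have js: "real j * h \<le> s" "s \<le> real j * h + h"
    using assms by (auto simp: field_simps)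
  have jm: "j \<le> m"
  proof -
    have "real j * h \<le> real m * h" using js s by auto
    then show ?thesis using assms by simp
  qed
  have "\<bar>V0 \<omega>\<bar> * (s - real j * h) \<le> \<bar>V0 \<omega>\<bar> * h"
    using js by (intro mult_left_mono) auto
  moreover have "N (real j * h) \<omega> \<le> N (real m * h) \<omega>"
    using jm assms by (intro N_le) auto
  then have "2 * real (N (real j * h) \<omega>) * (\<bar>V0 \<omega>\<bar> * h) \<le> 2 * real (N (real m * h) \<omega>) * (\<bar>V0 \<omega>\<bar> * h)"
    using assms by (intro mult_right_mono mult_left_mono) auto
  moreover have "\<bar>telegraph N V0 s \<omega> - telegraph N V0 (real j * h) \<omega>\<bar> \<le> \<bar>V0 \<omega>\<bar> * (s - real j * h)"
    using assms js by (intro telegraph_lipschitz) auto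
  ultimately have "running_max (telegraph N V0) (real m * h) \<omega>
    \<le> V0 \<omega> * h * real_of_int (grid_walk N h j \<omega>) + (2 * real (N (real m * h) \<omega>) + 1) * (\<bar>V0 \<omega>\<bar> * h)"
    using telegraph_grid[OF assms(1), of h j] s(2) assms(2) unfolding ring_distribs by linarith
  with jm show ?thesis by blast
qed

lemma measurable_N[measurable]: "0 \<le> s \<Longrightarrow> N s \<in> measurable M (count_space UNIV)"
  by (rule N_measurable)

lemma measurable_V0[measurable]: "V0 \<in> borel_measurable M"
  by (rule V0_measurable)

text \<open>The maximum is a pointwise limit of maxima over finitely many grid points, since on each
  path the error is a fixed multiple of the step.\<close>

lemma running_max_measurable:
  assumes "0 \<le> t"
  shows "running_max (telegraph N V0) t \<in> borel_measurable M"
proof -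
  \<comment> \<open>\<open>Suc m\<close> cells, so that the step is never a division by
    zero.\<close>
  define h where "h m = t / real (Suc m)" for m
  define X where "X m \<omega> = Max ((\<lambda>j. V0 \<omega> * h m * real_of_int (grid_walk N (h m) j \<omega>)) ` {..Suc m})" for m \<omega>
  show ?thesis
  proof (cases "t = 0")
    case True
    have "running_max (telegraph N V0) t \<omega> = 0" for \<omega>
      by (simp add: running_max_def True telegraph_def)
    then show ?thesis by (simp cong: measurable_cong)
  next
    case False
    with assms have t: "0 < t" by simp
    have h: "0 < h m" "real (Suc m) * h m = t" for m
      using t by (auto simp: h_def)
    show ?thesis
    proof (rule borel_measurable_LIMSEQ_real)
      fix m
      have "(\<lambda>\<omega>. N (real i * h m) \<omega>) \<in> measurable M (count_space UNIV)" for i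
        using h(1)[of m] by (intro measurable_N) simp
      then have "(\<lambda>\<omega>. (-1) ^ N (real i * h m) \<omega> :: real) \<in> borel_measurable M" for i
        by measurable
      then show "X m \<in> borel_measurable M"
        unfolding X_def[abs_def] grid_walk_def of_int_sum of_int_power of_int_minus of_int_1
        by (intro borel_measurable_Max borel_measurable_times borel_measurable_sum) auto
    next
      fix \<omega> assume \<omega>: "\<omega> \<in> space M"
      let ?K = "2 * real (N t \<omega>) + 1"
      have bound: "\<bar>X m \<omega> - running_max (telegraph N V0) t \<omega>\<bar> \<le> ?K * (\<bar>V0 \<omega>\<bar> * h m)" for m
      proof -
        have "V0 \<omega> * h m * real_of_int (grid_walk N (h m) j \<omega>)
            \<le> running_max (telegraph N V0) t \<omega> + ?K * (\<bar>V0 \<omega>\<bar> * h m)" if "j \<le> Suc m" for j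
          using grid_le_running_max[OF \<omega> less_imp_le[OF h(1)[of m]] that] unfolding h(2) .
        then have "X m \<omega> \<le> running_max (telegraph N V0) t \<omega> + ?K * (\<bar>V0 \<omega>\<bar> * h m)"
          unfolding X_def by (subst Max_le_iff) auto
        moreover obtain j where "j \<le> Suc m" "running_max (telegraph N V0) t \<omega>
            \<le> V0 \<omega> * h m * real_of_int (grid_walk N (h m) j \<omega>) + ?K * (\<bar>V0 \<omega>\<bar> * h m)"
          using running_max_le_grid[OF \<omega> h(1), of "Suc m" m] unfolding h(2) by blast
        moreover from this have "V0 \<omega> * h m * real_of_int (grid_walk N (h m) j \<omega>) \<le> X m \<omega>"
          unfolding X_def by (intro Max_ge) auto
        ultimately show ?thesis by linarith
      qed
      have lim: "(\<lambda>m. ?K * (\<bar>V0 \<omega>\<bar> * h m)) \<longlonglongrightarrow> 0"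
        unfolding h_def by (intro tendsto_mult_right_zero LIMSEQ_Suc[OF lim_const_over_n])
      have "\<forall>\<^sub>F m in sequentially. norm (X m \<omega> - running_max (telegraph N V0) t \<omega>) \<le> ?K * (\<bar>V0 \<omega>\<bar> * h m)"
        unfolding real_norm_def by (intro always_eventually allI bound)
      then have "(\<lambda>m. X m \<omega> - running_max (telegraph N V0) t \<omega>) \<longlonglongrightarrow> 0"
        using lim by (rule Lim_null_comparison)
      then show "(\<lambda>m. X m \<omega>) \<longlonglongrightarrow> running_max (telegraph N V0) t \<omega>"
        by (rule LIM_zero_cancel)
    qed
  qed
qed

end

section \<open>The conditional law of the maximum\<close>

text \<open>Finite Borel measures on the line are determined by their distribution functions. Since
  \<open>\<mu>\<close> may have mass outside the open interval, in particular atoms at its ends, the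
  comparison is made after cutting it down to the interval.\<close>

lemma has_density_on_Ioo:
  fixes \<mu> :: "real measure"
  assumes \<mu>: "finite_borel_measure \<mu>" and ab: "a < b"
    and F: "\<And>x. a \<le> x \<Longrightarrow> x \<le> b \<Longrightarrow> (F has_real_derivative f x) (at x)"
    and nonneg: "\<And>x. a \<le> x \<Longrightarrow> x \<le> b \<Longrightarrow> 0 \<le> f x"
    and f[measurable]: "f \<in> borel_measurable borel"
    and cdf: "\<And>x. a < x \<Longrightarrow> x < b \<Longrightarrow> measure \<mu> {a<..x} = F x - F a"
  shows "has_density_on \<mu> f {a<..<b}"
proof -
  interpret \<mu>: finite_borel_measure \<mu> by fact
  have sets_\<mu>[measurable_cong]: "sets \<mu> = sets borel" by (rule \<mu>.M_is_borel)
  have F_mono: "F x \<le> F y" if "a \<le> x" "x \<le> y" "y \<le> b" for x y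
    by (rule DERIV_nonneg_imp_nondecreasing[OF that(2)]) (use F nonneg that in \<open>meson order_trans\<close>)
  \<comment> \<open>Both measures are extended by zero to the whole line, where uniqueness by
    distribution functions applies.\<close>
  define \<mu>I where "\<mu>I = density \<mu> (indicator {a<..<b})"
  define \<nu> where "\<nu> = density lborel (\<lambda>x. ennreal (f x) * indicator {a<..<b} x)"
  have emeasure_\<mu>I: "emeasure \<mu>I A = emeasure \<mu> ({a<..<b} \<inter> A)" if "A \<in> sets borel" for A
    using that by (simp add: \<mu>I_def emeasure_density sets_\<mu> nn_integral_cmult_indicator
      flip: indicator_inter_arith)
  have \<nu>_Iic: "emeasure \<nu> ({a<..<b} \<inter> {..x}) = ennreal (F (min x b) - F a)" if "a < x" for x
  proof -
    have "emeasure \<nu> ({a<..<b} \<inter> {..x}) =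
        (\<integral>\<^sup>+ y. ennreal (f y) * indicator {a<..<b} y * indicator ({a<..<b} \<inter> {..x}) y \<partial>lborel)"
      unfolding \<nu>_def by (rule emeasure_density) auto
    \<comment> \<open>The endpoints are null sets; adding them gives the closed interval for the
      fundamental theorem of calculus.\<close>
    also have "\<dots> = (\<integral>\<^sup>+ y. ennreal (f y) * indicator {a..min x b} y \<partial>lborel)"
    proof (rule nn_integral_cong_AE)
      show "AE y in lborel. ennreal (f y) * indicator {a<..<b} y * indicator ({a<..<b} \<inter> {..x}) y =
          ennreal (f y) * indicator {a..min x b} y"
        using AE_lborel_singleton[of a] AE_lborel_singleton[of b]
        by eventually_elim (auto split: split_indicator)
    qed
    also have "\<dots> = ennreal (F (min x b) - F a)"
      using that ab by (intro nn_integral_FTC_Icc F nonneg) (auto intro: DERIV_subset F)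
    finally show ?thesis .
  qed
  have \<nu>_restrict: "emeasure \<nu> ({a<..<b} \<inter> A) = emeasure \<nu> A" if "A \<in> sets borel" for A
    using that by (auto simp: \<nu>_def emeasure_density intro!: nn_integral_cong split: split_indicator)
  have fin_\<nu>: "finite_borel_measure \<nu>"
  proof -
    have "{a<..<b} \<inter> UNIV = {a<..<b} \<inter> {..b}" by auto
    then have total: "emeasure \<nu> UNIV = ennreal (F (min b b) - F a)"
      using \<nu>_restrict[OF borel_open[OF open_UNIV]] \<nu>_Iic[OF ab] by (simp only:)
    have space: "space \<nu> = UNIV" and sets: "sets \<nu> = sets borel" by (simp_all add: \<nu>_def)
    show ?thesis
      by (intro finite_borel_measure.intro finite_borel_measure_axioms.intro finite_measureI)
        (simp_all only: space sets total infinity_ennreal_def ennreal_neq_top not_False_eq_True)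
  qed
  have fin_\<mu>I: "finite_borel_measure \<mu>I"
  proof (intro finite_borel_measure.intro finite_borel_measure_axioms.intro finite_measureI)
    have "emeasure \<mu>I (space \<mu>I) = emeasure \<mu> ({a<..<b} \<inter> UNIV)"
      using emeasure_\<mu>I[of UNIV] by (simp add: \<mu>I_def \<mu>.borel_UNIV)
    then show "emeasure \<mu>I (space \<mu>I) \<noteq> \<infinity>" by simp
  qed (simp add: \<mu>I_def sets_\<mu>)
  interpret \<mu>I: finite_borel_measure \<mu>I by fact
  have cdf_\<nu>: "cdf \<nu> x = (if x \<le> a then 0 else F (min x b) - F a)" for x
  proof (cases "x \<le> a")
    case True
    then have "{a<..<b} \<inter> {..x} = {}" by auto
    then show ?thesis using True \<nu>_restrict[of "{..x}"] by (simp add: cdf_def measure_def)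
  next
    case False
    then show ?thesis
      using \<nu>_Iic[of x] \<nu>_restrict[of "{..x}"] F_mono[of a "min x b"] ab by (simp add: cdf_def measure_def)
  qed
  have measure_\<mu>I: "measure \<mu>I A = measure \<mu> ({a<..<b} \<inter> A)" if "A \<in> sets borel" for A
    using emeasure_\<mu>I[OF that] by (simp add: measure_def)
  have cdf_\<mu>I_inside: "cdf \<mu>I x = F x - F a" if "a < x" "x < b" for x
  proof -
    have "{a<..<b} \<inter> {..x} = {a<..x}" using that by auto
    then show ?thesis using cdf[OF that] measure_\<mu>I[of "{..x}"] by (simp add: cdf_def)
  qed
  \<comment> \<open>The hypothesis on \<open>\<mu>\<close> stops short of \<open>b\<close>; the
    total mass of the open interval is recovered as a left limit.\<close>
  have "(cdf \<mu>I \<longlongrightarrow> F b - F a) (at_left b)"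
  proof (rule Lim_transform_eventually)
    have "isCont F b" using F[of b] ab by (intro DERIV_isCont) auto
    then show "((\<lambda>x. F x - F a) \<longlongrightarrow> F b - F a) (at_left b)"
      by (intro tendsto_diff tendsto_const) (simp add: isCont_def filterlim_at_split)
    show "\<forall>\<^sub>F x in at_left b. F x - F a = cdf \<mu>I x"
      using eventually_at_left_real[OF ab] by eventually_elim (simp add: cdf_\<mu>I_inside)
  qed
  then have "measure \<mu>I {..<b} = F b - F a"
    by (rule tendsto_unique[OF trivial_limit_at_left_real \<mu>I.cdf_at_left])
  moreover have "measure \<mu>I {..x} = measure \<mu>I {..<b}" if "b \<le> x" for x
    using that by (simp add: measure_\<mu>I) (rule arg_cong[where f = "measure \<mu>"], auto)
  ultimately have cdf_\<mu>I_right: "cdf \<mu>I x = F b - F a" if "b \<le> x" for x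
    using that by (simp add: cdf_def)
  have cdf_\<mu>I_left: "cdf \<mu>I x = 0" if "x \<le> a" for x
  proof -
    have "{a<..<b} \<inter> {..x} = {}" using that by auto
    then show ?thesis using measure_\<mu>I[of "{..x}"] by (simp add: cdf_def)
  qed
  have "cdf \<mu>I x = cdf \<nu> x" for x
    using ab cdf_\<mu>I_left[of x] cdf_\<mu>I_inside[of x] cdf_\<mu>I_right[of x]
    by (cases "x < b") (auto simp: cdf_\<nu> min_def)
  then have eq: "\<mu>I = \<nu>"
    by (intro cdf_unique' fin_\<mu>I fin_\<nu> ext)
  show ?thesis
    unfolding has_density_on_def
  proof (rule measure_eqI)
    show "sets (restrict_space \<mu> {a<..<b}) = sets (density (restrict_space lborel {a<..<b}) (\<lambda>x. ennreal (f x)))"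
      by (simp add: sets_restrict_space sets_\<mu>)
    fix A assume "A \<in> sets (restrict_space \<mu> {a<..<b})"
    then have A: "A \<in> sets borel" "A \<subseteq> {a<..<b}" and A': "A \<in> sets (restrict_space lborel {a<..<b})"
      by (auto simp: sets_restrict_space sets_\<mu>)
    have "emeasure (restrict_space \<mu> {a<..<b}) A = emeasure \<mu> ({a<..<b} \<inter> A)"
      using A by (subst emeasure_restrict_space) (auto simp: sets_\<mu> \<mu>.borel_UNIV Int_absorb1)
    also have "\<dots> = emeasure \<nu> A"
      using A emeasure_\<mu>I eq by simp
    also have "\<dots> = (\<integral>\<^sup>+ x. ennreal (f x) * indicator A x * indicator {a<..<b} x \<partial>lborel)"
      unfolding \<nu>_def using A by (subst emeasure_density) (auto simp: ac_simps)
    also have "\<dots> = (\<integral>\<^sup>+ x. ennreal (f x) * indicator A x \<partial>restrict_space lborel {a<..<b})"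
      by (subst nn_integral_restrict_space) auto
    also have "\<dots> = emeasure (density (restrict_space lborel {a<..<b}) (\<lambda>x. ennreal (f x))) A"
      using A' by (subst emeasure_density) (auto intro: measurable_restrict_space1)
    finally show "emeasure (restrict_space \<mu> {a<..<b}) A =
      emeasure (density (restrict_space lborel {a<..<b}) (\<lambda>x. ennreal (f x))) A" .
  qed
qed

context symmetric_telegraph
begin

section \<open>Law of the grid increments\<close>

lemma N_eq_sum_increments:
  assumes "\<omega> \<in> space M" "0 \<le> h" "j \<le> m"
  shows "N (real j * h) \<omega> = sum_list (take j (grid_increments N h m \<omega>))"
  using assms(3)
proof (induction j)
  case 0
  show ?case using N_zero assms(1) by simp
next
  case (Suc j)
  have "N (real j * h) \<omega> \<le> N (real (Suc j) * h) \<omega>"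
    using assms by (intro N_le) (auto intro!: mult_right_mono)
  moreover have "grid_increments N h m \<omega> ! j = N (real (Suc j) * h) \<omega> - N (real j * h) \<omega>"
    using Suc.prems by (simp add: grid_increments_def)
  moreover have "j < length (grid_increments N h m \<omega>)"
    using Suc.prems by (simp add: grid_increments_def)
  ultimately show ?case
    using Suc by (simp add: take_Suc_conv_app_nth del: of_nat_Suc)
qed

lemma grid_walk_eq_increments:
  assumes "\<omega> \<in> space M" "0 \<le> h" "j \<le> m"
  shows "grid_walk N h j \<omega> = (\<Sum>i<j. (-1) ^ sum_list (take i (grid_increments N h m \<omega>)))"
  unfolding grid_walk_def
  using assms(3) by (intro sum.cong refl) (simp add: N_eq_sum_increments[OF assms(1,2), of _ m])

text \<open>The second sigma-algebra of \<open>V0_indep\<close>. Measurability of a path event in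
  \<open>M\<close> alone would not give its independence of \<open>V0\<close>.\<close>

definition path_algebra :: "'a measure" where
  "path_algebra = vimage_algebra (space M) (\<lambda>\<omega>. \<lambda>s\<in>{0..}. N s \<omega>) (PiM {0..} (\<lambda>_. count_space UNIV))"

lemma space_path_algebra[simp]: "space path_algebra = space M"
  by (simp add: path_algebra_def)

lemma N_measurable_path:
  assumes "0 \<le> s"
  shows "N s \<in> measurable path_algebra (count_space UNIV)"
proof -
  have "(\<lambda>\<omega>. \<lambda>s\<in>{0..}. N s \<omega>) \<in> measurable path_algebra (PiM {0..} (\<lambda>_. count_space UNIV))"
    unfolding path_algebra_def by (intro measurable_vimage_algebra1) (auto simp: space_PiM)
  then have "(\<lambda>\<omega>. (\<lambda>s\<in>{0..}. N s \<omega>) s) \<in> measurable path_algebra (count_space UNIV)"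
    by (rule measurable_compose[OF _ measurable_component_singleton]) (use assms in simp)
  then show ?thesis using assms by simp
qed

lemma prob_down_and_path_event:
  assumes "{\<omega> \<in> space M. P \<omega>} \<in> sets path_algebra"
  shows "prob {\<omega> \<in> space M. V0 \<omega> = - c \<and> P \<omega>} = prob {\<omega> \<in> space M. P \<omega>} / 2"
proof -
  have "V0 -` {- c} \<inter> space M \<in> sets (vimage_algebra (space M) V0 borel)"
    by (rule in_vimage_algebra) simp
  from indep_setD[OF V0_indep this assms[unfolded path_algebra_def]]
  have "prob (V0 -` {- c} \<inter> space M \<inter> {\<omega> \<in> space M. P \<omega>}) =
    prob (V0 -` {- c} \<inter> space M) * prob {\<omega> \<in> space M. P \<omega>}" .
  moreover have "V0 -` {- c} \<inter> space M = {\<omega> \<in> space M. V0 \<omega> = - c}" by auto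
  moreover have "{\<omega> \<in> space M. V0 \<omega> = - c} \<inter> {\<omega> \<in> space M. P \<omega>} =
    {\<omega> \<in> space M. V0 \<omega> = - c \<and> P \<omega>}" by auto
  ultimately show ?thesis using V0_neg by simp
qed

lemma prob_increment:
  assumes "0 \<le> s" "s < u"
  shows "prob ((\<lambda>\<omega>. N u \<omega> - N s \<omega>) -` {k} \<inter> space M) =
    (rate * (u - s)) ^ k / fact k * exp (- (rate * (u - s)))"
proof -
  have "(\<lambda>\<omega>. N u \<omega> - N s \<omega>) \<in> measurable M (count_space UNIV)"
    using assms N_measurable[of s] N_measurable[of u] by simp
  then have "prob ((\<lambda>\<omega>. N u \<omega> - N s \<omega>) -` {k} \<inter> space M) =
      measure (distr M (count_space UNIV) (\<lambda>\<omega>. N u \<omega> - N s \<omega>)) {k}"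
    by (subst measure_distr) auto
  also have "\<dots> = pmf (poisson_pmf (rate * (u - s))) k"
    by (simp add: N_increments[OF assms] pmf.rep_eq)
  finally show ?thesis
    using assms rate_pos by simp
qed

lemma prob_down_and_count:
  assumes "0 < t"
  shows "prob {\<omega> \<in> space M. V0 \<omega> = - c \<and> N t \<omega> = n} = exp (- (rate * t)) * (rate * t) ^ n / 2 / fact n"
proof -
  have "N t -` {n} \<inter> space path_algebra \<in> sets path_algebra"
    by (rule measurable_sets[OF N_measurable_path]) (use assms in auto)
  moreover have vimage: "N t -` {n} \<inter> space M = {\<omega> \<in> space M. N t \<omega> = n}" by auto
  ultimately have "prob {\<omega> \<in> space M. V0 \<omega> = - c \<and> N t \<omega> = n} = prob (N t -` {n} \<inter> space M) / 2"
    by (simp add: prob_down_and_path_event)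
  also have "N t -` {n} \<inter> space M = (\<lambda>\<omega>. N t \<omega> - N 0 \<omega>) -` {n} \<inter> space M"
    using N_zero by auto
  finally show ?thesis
    using prob_increment[of 0 t n] assms by (simp add: ac_simps)
qed

text \<open>Turns an equation between lists into finitely many conditions on increments, the form
  suited to measurability and independence.\<close>

lemma grid_increments_eq_iff:
  "grid_increments N h m \<omega> = ys \<longleftrightarrow>
    length ys = m \<and> (\<forall>i<m. N (real (Suc i) * h) \<omega> - N (real i * h) \<omega> = ys ! i)"
  by (auto simp: grid_increments_def list_eq_iff_nth_eq)

lemma grid_increments_event:
  assumes "0 \<le> h"
  shows "{\<omega> \<in> space M. grid_increments N h m \<omega> = ys} \<in> sets path_algebra"
proof -
  have "(\<lambda>\<omega>. N (real i * h) \<omega>) \<in> measurable path_algebra (count_space UNIV)" for i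
    using assms by (intro N_measurable_path) simp
  note [measurable] = this
  have "{\<omega> \<in> space path_algebra. length ys = m \<and>
      (\<forall>i<m. N (real (Suc i) * h) \<omega> - N (real i * h) \<omega> = ys ! i)} \<in> sets path_algebra"
    by measurable
  then show ?thesis
    unfolding grid_increments_eq_iff space_path_algebra .
qed

text \<open>The entries are 0 or 1, so the factorials in the Poisson weights are 1 and the product
  depends on the list only through its length and sum: all lists in \<open>turn_lists m n\<close>
  are equally likely.\<close>

lemma prob_grid_increments:
  assumes h: "0 < h" and m: "0 < m" and ys: "ys \<in> turn_lists m n"
  shows "prob {\<omega> \<in> space M. grid_increments N h m \<omega> = ys} = exp (- (rate * (real m * h))) * (rate * h) ^ n"
proof -
  let ?X = "\<lambda>i \<omega>. N (real (Suc i) * h) \<omega> - N (real i * h) \<omega>"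
  have len: "length ys = m" and "set ys \<subseteq> {0, 1}" and sum: "sum_list ys = n"
    using ys by (auto simp: turn_lists_def)
  then have bit: "ys ! i \<in> {0, 1}" if "i < m" for i
    using that nth_mem[of i ys] by blast
  have "indep_vars (\<lambda>_. count_space UNIV) ?X {..<m}"
    using h by (intro N_indep_increments[of "\<lambda>i. real i * h" m]) (auto simp: strict_mono_on_def)
  then have "prob (\<Inter>i\<in>{..<m}. ?X i -` {ys ! i} \<inter> space M) = (\<Prod>i\<in>{..<m}. prob (?X i -` {ys ! i} \<inter> space M))"
    by (rule indep_varsD_finite) (use m in auto)
  also have "\<dots> = (\<Prod>i\<in>{..<m}. (rate * h) ^ (ys ! i) * exp (- (rate * h)))"
  proof (rule prod.cong[OF refl])
    fix i assume "i \<in> {..<m}"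
    then have "fact (ys ! i) = (1 :: real)" using bit[of i] by auto
    moreover have "real i * h < real (Suc i) * h" "real (Suc i) * h - real i * h = h"
      using h by (auto simp: algebra_simps)
    ultimately show "prob (?X i -` {ys ! i} \<inter> space M) = (rate * h) ^ (ys ! i) * exp (- (rate * h))"
      using h by (subst prob_increment) simp_all
  qed
  also have "\<dots> = (rate * h) ^ (\<Sum>i<m. ys ! i) * exp (- (rate * h)) ^ m"
    by (simp add: prod.distrib power_sum)
  also have "(\<Sum>i<m. ys ! i) = n"
    using sum len by (simp add: sum_list_sum_nth atLeast0LessThan)
  also have "exp (- (rate * h)) ^ m = exp (- (rate * (real m * h)))"
    by (simp add: exp_of_nat_mult[symmetric] ac_simps)
  also have "(\<Inter>i\<in>{..<m}. ?X i -` {ys ! i} \<inter> space M) = {\<omega> \<in> space M. grid_increments N h m \<omega> = ys}"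
    using m len by (auto simp: grid_increments_eq_iff)
  finally show ?thesis by simp
qed

lemma down_and_grid_increments_event:
  assumes "0 \<le> h" "finite S"
  shows "{\<omega> \<in> space M. V0 \<omega> = - c \<and> grid_increments N h m \<omega> \<in> S} \<in> events"
proof -
  have "(\<lambda>\<omega>. N (real i * h) \<omega>) \<in> measurable M (count_space UNIV)" for i
    using assms by (intro N_measurable) simp
  note [measurable] = this
  have "{\<omega> \<in> space M. V0 \<omega> = - c \<and> (\<exists>ys\<in>S. length ys = m \<and>
      (\<forall>i<m. N (real (Suc i) * h) \<omega> - N (real i * h) \<omega> = ys ! i))} \<in> events"
    using assms(2) by measurable
  moreover have "grid_increments N h m \<omega> \<in> S \<longleftrightarrow> (\<exists>ys\<in>S. length ys = m \<and>
      (\<forall>i<m. N (real (Suc i) * h) \<omega> - N (real i * h) \<omega> = ys ! i))" for \<omega>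
    by (metis grid_increments_eq_iff)
  ultimately show ?thesis by (simp only:)
qed

lemma prob_down_and_grid_increments:
  assumes t: "0 < t" and m: "0 < m" and S: "S \<subseteq> turn_lists m n"
  shows "prob {\<omega> \<in> space M. V0 \<omega> = - c \<and> grid_increments N (t / real m) m \<omega> \<in> S} =
    exp (- (rate * t)) * (rate * t) ^ n / 2 * (real (card S) / real m ^ n)"
proof -
  define h where "h = t / real m"
  have h: "0 < h" "real m * h = t" using t m by (auto simp: h_def)
  have fin: "finite S" using S finite_turn_lists finite_subset by blast
  let ?E = "\<lambda>ys. {\<omega> \<in> space M. V0 \<omega> = - c \<and> grid_increments N h m \<omega> \<in> {ys}}"
  have "{\<omega> \<in> space M. V0 \<omega> = - c \<and> grid_increments N h m \<omega> \<in> S} = (\<Union>ys\<in>S. ?E ys)"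
    by auto
  also have "prob \<dots> = (\<Sum>ys\<in>S. prob (?E ys))"
    using h down_and_grid_increments_event[of h "{_}" m]
    by (intro finite_measure_finite_Union fin) (auto simp: disjoint_family_on_def)
  also have "\<dots> = (\<Sum>ys\<in>S. exp (- (rate * t)) * (rate * h) ^ n / 2)"
  proof (rule sum.cong[OF refl])
    fix ys assume "ys \<in> S"
    have "prob (?E ys) = prob {\<omega> \<in> space M. grid_increments N h m \<omega> = ys} / 2"
      using prob_down_and_path_event[OF grid_increments_event[of h m ys]] h by simp
    also have "\<dots> = exp (- (rate * t)) * (rate * h) ^ n / 2"
      using prob_grid_increments[OF h(1) m, of ys n] \<open>ys \<in> S\<close> S h by auto
    finally show "prob (?E ys) = exp (- (rate * t)) * (rate * h) ^ n / 2" .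
  qed
  also have "\<dots> = exp (- (rate * t)) * (rate * t) ^ n / 2 * (real (card S) / real m ^ n)"
    by (simp add: h_def power_divide ac_simps)
  finally show ?thesis by (simp add: h_def)
qed

section \<open>Bounds on a finite grid\<close>

lemma running_max_event:
  assumes "0 \<le> t"
  shows "{\<omega> \<in> space M. V0 \<omega> = - c \<and> N t \<omega> = n \<and> running_max (telegraph N V0) t \<omega> \<le> x} \<in> events"
  using running_max_measurable[OF assms] N_measurable[OF assms] by measurable

lemma down_and_count_event:
  assumes "0 \<le> t"
  shows "{\<omega> \<in> space M. V0 \<omega> = - c \<and> N t \<omega> = n} \<in> events"
  using N_measurable[OF assms] by measurable

text \<open>Every list that stays below the barrier \<open>B - A\<close> forces the maximum below
  \<open>x\<close>, once the grid error \<open>2 * n + 1\<close> is allowed for. As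
  \<open>V0 \<omega> = - c\<close>, the upward displacement is the negative of
  \<open>grid_walk\<close>, whence the start direction -1.\<close>

lemma prob_running_max_ge_grid:
  assumes t: "0 < t" and AB: "A \<le> B" "0 < B"
    and x: "(real B - real A + 2 * real n + 1) * (c * (t / real (A + B))) \<le> x"
  shows "exp (- (rate * t)) * (rate * t) ^ n / 2 * (real_of_int (signed_choose 1 n A B) / real (A + B) ^ n)
    \<le> prob {\<omega> \<in> space M. V0 \<omega> = - c \<and> N t \<omega> = n \<and> running_max (telegraph N V0) t \<omega> \<le> x}"
proof -
  define m where "m = A + B"
  define h where "h = t / real m"
  define S where "S = barrier_lists (-1) (int B - int A) m n"
  have m: "0 < m" and h: "0 < h" "real m * h = t" using t AB by (auto simp: m_def h_def)
  have S: "S \<subseteq> turn_lists m n" by (auto simp: S_def barrier_lists_def)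
  have "prob {\<omega> \<in> space M. V0 \<omega> = - c \<and> grid_increments N h m \<omega> \<in> S}
    \<le> prob {\<omega> \<in> space M. V0 \<omega> = - c \<and> N t \<omega> = n \<and> running_max (telegraph N V0) t \<omega> \<le> x}"
  proof (rule finite_measure_mono[OF _ running_max_event], safe)
    fix \<omega> assume \<omega>: "\<omega> \<in> space M" and V0: "V0 \<omega> = - c" and inS: "grid_increments N h m \<omega> \<in> S"
    let ?ys = "grid_increments N h m \<omega>"
    have ys: "length ?ys = m" "sum_list ?ys = n" "below_barrier (-1) (int B - int A) ?ys"
      using inS by (auto simp: S_def barrier_lists_def turn_lists_def)
    show "N t \<omega> = n"
      using N_eq_sum_increments[OF \<omega> less_imp_le[OF h(1)] order.refl[of m]] ys h by simp
    obtain j where j: "j \<le> m" "running_max (telegraph N V0) t \<omega>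
        \<le> - c * h * real_of_int (grid_walk N h j \<omega>) + (2 * real n + 1) * (c * h)"
      using running_max_le_grid[OF \<omega> h(1), of m] c_pos unfolding h(2) V0 \<open>N t \<omega> = n\<close> by auto
    have "- grid_walk N h j \<omega> \<le> int B - int A"
      using below_barrier_imp_le[OF _ _ ys(3), of j] AB j(1) ys(1)
        grid_walk_eq_increments[OF \<omega> less_imp_le[OF h(1)] j(1)] by simp
    then have "- real_of_int (grid_walk N h j \<omega>) \<le> real B - real A"
      by linarith
    then have "- real_of_int (grid_walk N h j \<omega>) * (c * h) \<le> (real B - real A) * (c * h)"
      using c_pos h by (intro mult_right_mono) auto
    then have "running_max (telegraph N V0) t \<omega> \<le> (real B - real A + 2 * real n + 1) * (c * h)"
      using j(2) by (simp add: algebra_simps)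
    also have "\<dots> \<le> x" using x by (simp add: h_def m_def)
    finally show "running_max (telegraph N V0) t \<omega> \<le> x" .
  qed (use t in auto)
  moreover have "real (card S) = real_of_int (signed_choose 1 n A B)"
    using card_barrier_lists[OF AB(1), of n] by (metis S_def m_def of_int_of_nat_eq)
  ultimately show ?thesis
    using prob_down_and_grid_increments[OF t m S] by (simp add: h_def m_def)
qed

text \<open>The second summand of the bound accounts for the paths with several switches in one cell.\<close>

lemma prob_running_max_le_grid:
  assumes t: "0 < t" and AB: "A \<le> B" "0 < B"
    and x: "x < (real B - real A - 2 * real n - 1) * (c * (t / real (A + B)))"
  shows "prob {\<omega> \<in> space M. V0 \<omega> = - c \<and> N t \<omega> = n \<and> running_max (telegraph N V0) t \<omega> \<le> x}
    \<le> exp (- (rate * t)) * (rate * t) ^ n / 2 * (real_of_int (signed_choose 1 n A B) / real (A + B) ^ n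
      + (1 / fact n - real ((A + B) choose n) / real (A + B) ^ n))"
proof -
  define m where "m = A + B"
  define h where "h = t / real m"
  define S where "S = barrier_lists (-1) (int B - int A) m n"
  have m: "0 < m" and h: "0 < h" "real m * h = t" using t AB by (auto simp: m_def h_def)
  have S: "S \<subseteq> turn_lists m n" by (auto simp: S_def barrier_lists_def)
  let ?E = "\<lambda>S. {\<omega> \<in> space M. V0 \<omega> = - c \<and> grid_increments N h m \<omega> \<in> S}"
  let ?D = "{\<omega> \<in> space M. V0 \<omega> = - c \<and> N t \<omega> = n}"
  have ev: "?E S \<in> events" "?E (turn_lists m n) \<in> events" "?D \<in> events"
    using h t finite_turn_lists finite_subset[OF S finite_turn_lists]
    by (auto intro!: down_and_grid_increments_event down_and_count_event)
  have sub: "?E (turn_lists m n) \<subseteq> ?D"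
  proof safe
    fix \<omega> assume "\<omega> \<in> space M" "grid_increments N h m \<omega> \<in> turn_lists m n"
    then show "N t \<omega> = n"
      using N_eq_sum_increments[of \<omega> h m m] h by (simp add: turn_lists_def)
  qed
  \<comment> \<open>A path in the event either has several switches in some cell, and lies in the
    difference set, or has a 0/1 list that must stay below the barrier.\<close>
  have "{\<omega> \<in> space M. V0 \<omega> = - c \<and> N t \<omega> = n \<and> running_max (telegraph N V0) t \<omega> \<le> x}
    \<subseteq> ?E S \<union> (?D - ?E (turn_lists m n))"
  proof safe
    fix \<omega> assume \<omega>: "\<omega> \<in> space M" and V0: "V0 \<omega> = - c" and n: "n = N t \<omega>"
      and le: "running_max (telegraph N V0) t \<omega> \<le> x"
      and turn: "grid_increments N h m \<omega> \<in> turn_lists m (N t \<omega>)"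
    let ?ys = "grid_increments N h m \<omega>"
    have len: "length ?ys = m" by (simp add: grid_increments_def)
    have "below_barrier (-1) (int B - int A) ?ys"
    proof (rule below_barrier_if_less)
      fix j assume "j \<le> length ?ys"
      then have j: "j \<le> m" by (simp add: len)
      have "- c * h * real_of_int (grid_walk N h j \<omega>) \<le>
          running_max (telegraph N V0) t \<omega> + (2 * real n + 1) * (c * h)"
        using grid_le_running_max[OF \<omega> less_imp_le[OF h(1)] j] c_pos unfolding h(2) V0 n by simp
      \<comment> \<open>The margin in the hypothesis on \<open>x\<close> cancels the grid error
        exactly and keeps the inequality strict, as \<open>below_barrier_if_less\<close>
        requires.\<close>
      also have "\<dots> < (real B - real A - 2 * real n - 1) * (c * h) + (2 * real n + 1) * (c * h)"
        using le x by (simp add: h_def m_def)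
      also have "\<dots> = (real B - real A) * (c * h)"
        by (simp add: algebra_simps)
      finally have "- real_of_int (grid_walk N h j \<omega>) * (c * h) < (real B - real A) * (c * h)"
        by (simp add: ac_simps)
      then have "- real_of_int (grid_walk N h j \<omega>) < real B - real A"
        by (rule mult_right_less_imp_less) (use c_pos h in simp)
      then have "- grid_walk N h j \<omega> < int B - int A"
        by linarith
      then show "- 1 * (\<Sum>i<j. (-1) ^ sum_list (take i ?ys)) < int B - int A"
        using grid_walk_eq_increments[OF \<omega> less_imp_le[OF h(1)] j] by simp
    qed simp
    with turn show "?ys \<in> S" by (simp add: S_def barrier_lists_def n)
  qed
  then have "prob {\<omega> \<in> space M. V0 \<omega> = - c \<and> N t \<omega> = n \<and> running_max (telegraph N V0) t \<omega> \<le> x}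
    \<le> prob (?E S \<union> (?D - ?E (turn_lists m n)))"
    using ev by (intro finite_measure_mono) auto
  also have "\<dots> \<le> prob (?E S) + prob (?D - ?E (turn_lists m n))"
    using ev by (intro measure_Un_le) auto
  also have "prob (?D - ?E (turn_lists m n)) = prob ?D - prob (?E (turn_lists m n))"
    using ev sub by (intro finite_measure_Diff)
  also have "prob (?E (turn_lists m n)) =
      exp (- (rate * t)) * (rate * t) ^ n / 2 * (real (m choose n) / real m ^ n)"
    using prob_down_and_grid_increments[OF t m order.refl] by (simp add: h_def card_turn_lists)
  also have "prob (?E S) = exp (- (rate * t)) * (rate * t) ^ n / 2 * (real (card S) / real m ^ n)"
    using prob_down_and_grid_increments[OF t m S] by (simp add: h_def)
  also have "real (card S) = real_of_int (signed_choose 1 n A B)"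
    using card_barrier_lists[OF AB(1), of n] by (metis S_def m_def of_int_of_nat_eq)
  finally show ?thesis
    unfolding prob_down_and_count[OF t] m_def by (simp add: algebra_simps)
qed

section \<open>Passage to the limit\<close>

text \<open>With \<open>A\<close> close to \<open>p * m\<close> and \<open>B = m - A\<close>, the
  barrier height \<open>(B - A) * c * t / m\<close> tends to \<open>x\<close>. Shifting
  \<open>A\<close> by \<open>n + 1\<close> in either direction absorbs the grid error, and both
  bounds have the same limit.\<close>

lemma prob_running_max_le_pos:
  assumes t: "0 < t" and x: "0 < x" "x < c * t"
  shows "prob {\<omega> \<in> space M. V0 \<omega> = - c \<and> N t \<omega> = n \<and> running_max (telegraph N V0) t \<omega> \<le> x} =
    prob {\<omega> \<in> space M. V0 \<omega> = - c \<and> N t \<omega> = n} * signed_binomial n ((c * t - x) / (2 * c * t))"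
    (is "prob ?R = _")
proof -
  define p where "p = (c * t - x) / (2 * c * t)"
  \<comment> \<open>\<open>\<kappa> / fact n\<close> is the probability of the conditioning
    event.\<close>
  define \<kappa> where "\<kappa> = exp (- (rate * t)) * (rate * t) ^ n / 2"
  have ct: "0 < c * t" using c_pos t by simp
  have p: "0 < p" "p < 1 / 2" using x ct by (auto simp: p_def field_simps)
  have x_eq: "x = (1 - 2 * p) * (c * t)"
    using ct c_pos t by (simp add: p_def field_simps)
  have limit: "(\<lambda>m. real_of_int (signed_choose 1 n (A m) (m - A m)) / real m ^ n)
      \<longlonglongrightarrow> signed_binomial n p / fact n"
    if dev: "\<forall>\<^sub>F m in sequentially. \<bar>real (A m) - p * real m\<bar> \<le> C"
      and le: "\<forall>\<^sub>F m in sequentially. A m \<le> m - A m" for A C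
  proof (rule tendsto_signed_choose)
    show "(\<lambda>m. real (A m) / real m) \<longlonglongrightarrow> p"
      by (rule tendsto_if_bounded_deviation[OF dev])
    show "(\<lambda>m. real (m - A m) / real m) \<longlonglongrightarrow> 1 - p"
    proof (rule tendsto_if_bounded_deviation)
      show "\<forall>\<^sub>F m in sequentially. \<bar>real (m - A m) - (1 - p) * real m\<bar> \<le> C"
        using dev le by eventually_elim (simp add: of_nat_diff algebra_simps abs_le_iff)
    qed
  qed
  have scale: "u * (c * (t / real m)) = (u / real m) * (c * t)" for u m by simp
  have upper: "prob ?R \<le> \<kappa> * (signed_binomial n p / fact n)"
  proof -
    \<comment> \<open>A smaller \<open>A\<close> raises the barrier by at least
      \<open>2 * n + 2\<close> units, one more than the grid error.\<close>
    define A where "A m = nat \<lfloor>p * real m\<rfloor> - (n + 1)" for m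
    have large: "\<forall>\<^sub>F m in sequentially. real n + 2 \<le> p * real m"
      by (rule eventually_le_mult_real[OF p(1)])
    have A: "\<forall>\<^sub>F m in sequentially. real (A m) \<le> p * real m - real n - 1 \<and> p * real m - real n - 2 \<le> real (A m)"
      using large
    proof eventually_elim
      case (elim m)
      then have "real (A m) = real_of_int \<lfloor>p * real m\<rfloor> - (real n + 1)"
        unfolding A_def by (subst of_nat_diff) linarith+
      then show ?case by linarith
    qed
    have dev: "\<forall>\<^sub>F m in sequentially. \<bar>real (A m) - p * real m\<bar> \<le> real n + 2"
      using A by eventually_elim (simp add: abs_le_iff)
    have pm: "p * real m \<le> real m / 2" for m
      using mult_right_mono[OF less_imp_le[OF p(2)], of "real m"] by simp
    have le: "\<forall>\<^sub>F m in sequentially. A m \<le> m - A m"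
      using A
    proof eventually_elim
      case (elim m)
      then have "real (A m) \<le> real m / 2" using pm[of m] by linarith
      then show ?case by linarith
    qed
    \<comment> \<open>Hence the contribution of cells with several switches vanishes.\<close>
    have "(\<lambda>m. real (m choose n) / real m ^ n) \<longlonglongrightarrow> 1 ^ n / fact n"
      using tendsto_if_bounded_deviation[of "\<lambda>m. m" 1 0] by (intro tendsto_binomial_ratio) auto
    then have "(\<lambda>m. \<kappa> * (real_of_int (signed_choose 1 n (A m) (m - A m)) / real m ^ n
        + (1 / fact n - real (m choose n) / real m ^ n))) \<longlonglongrightarrow>
      \<kappa> * (signed_binomial n p / fact n + (1 / fact n - 1 ^ n / fact n))"
      by (intro tendsto_mult tendsto_add tendsto_diff tendsto_const limit[OF dev le])
    then have "(\<lambda>m. \<kappa> * (real_of_int (signed_choose 1 n (A m) (m - A m)) / real m ^ n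
        + (1 / fact n - real (m choose n) / real m ^ n))) \<longlonglongrightarrow> \<kappa> * (signed_binomial n p / fact n)"
      by simp
    moreover have "\<forall>\<^sub>F m in sequentially. prob ?R \<le>
        \<kappa> * (real_of_int (signed_choose 1 n (A m) (m - A m)) / real m ^ n
        + (1 / fact n - real (m choose n) / real m ^ n))"
      using A le eventually_gt_at_top[of 0]
    proof eventually_elim
      case (elim m)
      have m: "A m + (m - A m) = m" "0 < m - A m" using elim(2,3) by linarith+
      have "(1 - 2 * p) * real m < real (m - A m) - real (A m) - 2 * real n - 1"
        using elim(1,2) m(1) by (simp add: of_nat_diff algebra_simps)
      then have "1 - 2 * p < (real (m - A m) - real (A m) - 2 * real n - 1) / real m"
        using elim(3) by (simp only: pos_less_divide_eq of_nat_0_less_iff)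
      then have "x < (real (m - A m) - real (A m) - 2 * real n - 1) * (c * (t / real m))"
        unfolding x_eq scale using ct by (rule mult_strict_right_mono)
      with prob_running_max_le_grid[OF t elim(2) m(2), of x n] show ?case
        unfolding m(1) \<kappa>_def .
    qed
    ultimately show ?thesis
      by (rule tendsto_lowerbound) simp
  qed
  have lower: "\<kappa> * (signed_binomial n p / fact n) \<le> prob ?R"
  proof -
    define A where "A m = nat \<lceil>p * real m\<rceil> + (n + 1)" for m
    have A: "p * real m + real n + 1 \<le> real (A m) \<and> real (A m) \<le> p * real m + real n + 2" for m
    proof -
      have "0 \<le> p * real m" using p by simp
      then show ?thesis unfolding A_def by linarith
    qed
    have dev: "\<forall>\<^sub>F m in sequentially. \<bar>real (A m) - p * real m\<bar> \<le> real n + 2"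
    proof (intro always_eventually allI)
      show "\<bar>real (A m) - p * real m\<bar> \<le> real n + 2" for m
        using A[of m] by linarith
    qed
    \<comment> \<open>Here \<open>p < 1 / 2\<close>, that is \<open>0 < x\<close>, enters: there
      must be room to lower the barrier and still have \<open>A m \<le> m - A m\<close>.\<close>
    have "\<forall>\<^sub>F m in sequentially. 2 * real n + 4 \<le> (1 - 2 * p) * real m"
      by (rule eventually_le_mult_real) (use p in simp)
    then have le: "\<forall>\<^sub>F m in sequentially. A m \<le> m - A m"
    proof eventually_elim
      case (elim m)
      have "2 * real (A m) \<le> real m" using elim A[of m] by (simp add: algebra_simps)
      then show ?case by linarith
    qed
    have "(\<lambda>m. \<kappa> * (real_of_int (signed_choose 1 n (A m) (m - A m)) / real m ^ n)) \<longlonglongrightarrow>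
      \<kappa> * (signed_binomial n p / fact n)"
      by (intro tendsto_mult tendsto_add tendsto_diff tendsto_const limit[OF dev le])
    moreover have "\<forall>\<^sub>F m in sequentially.
        \<kappa> * (real_of_int (signed_choose 1 n (A m) (m - A m)) / real m ^ n) \<le> prob ?R"
      using le eventually_gt_at_top[of 0]
    proof eventually_elim
      case (elim m)
      have m: "A m + (m - A m) = m" "0 < m - A m" using elim by linarith+
      have "real (m - A m) - real (A m) + 2 * real n + 1 \<le> (1 - 2 * p) * real m"
        using elim m(1) A[of m] by (simp add: of_nat_diff algebra_simps)
      then have "(real (m - A m) - real (A m) + 2 * real n + 1) / real m \<le> 1 - 2 * p"
        using elim(2) by (simp only: pos_divide_le_eq of_nat_0_less_iff)
      then have "(real (m - A m) - real (A m) + 2 * real n + 1) * (c * (t / real m)) \<le> x"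
        unfolding x_eq scale using ct by (intro mult_right_mono) auto
      with prob_running_max_ge_grid[OF t elim(1) m(2), of n x] show ?case
        unfolding m(1) \<kappa>_def .
    qed
    ultimately show ?thesis
      by (rule tendsto_upperbound) simp
  qed
  from upper lower show ?thesis
    unfolding prob_down_and_count[OF t] p_def \<kappa>_def by simp
qed

text \<open>At \<open>x = 0\<close> the lowered barrier would be negative, so this value is obtained
  from positive levels by continuity of the measure from above and continuity of the polynomial
  \<open>signed_binomial n\<close>.\<close>

lemma prob_running_max_le:
  assumes t: "0 < t" and x: "0 \<le> x" "x < c * t"
  shows "prob {\<omega> \<in> space M. V0 \<omega> = - c \<and> N t \<omega> = n \<and> running_max (telegraph N V0) t \<omega> \<le> x} =
    prob {\<omega> \<in> space M. V0 \<omega> = - c \<and> N t \<omega> = n} * signed_binomial n ((c * t - x) / (2 * c * t))"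
proof (cases "x = 0")
  case False
  with assms show ?thesis by (intro prob_running_max_le_pos) auto
next
  case True
  \<comment> \<open>The denominator \<open>j + 2\<close> keeps every level strictly below
    \<open>c * t\<close>.\<close>
  define y where "y j = c * t / real (Suc (Suc j))" for j
  let ?R = "\<lambda>x. {\<omega> \<in> space M. V0 \<omega> = - c \<and> N t \<omega> = n \<and> running_max (telegraph N V0) t \<omega> \<le> x}"
  have ct: "0 < c * t" using c_pos t by simp
  have y: "0 < y j" "y j < c * t" for j
  proof -
    have "c * t * 1 < c * t * real (Suc (Suc j))"
      using ct by (intro mult_strict_left_mono) auto
    then show "0 < y j" "y j < c * t"
      using ct by (auto simp: y_def divide_less_eq)
  qed
  have y_lim: "y \<longlonglongrightarrow> 0"
    unfolding y_def[abs_def] by (intro LIMSEQ_Suc lim_const_over_n)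
  have "decseq (\<lambda>j. ?R (y j))"
    unfolding decseq_Suc_iff
  proof (intro allI subsetI)
    fix j \<omega> assume "\<omega> \<in> ?R (y (Suc j))"
    moreover have "y (Suc j) \<le> y j"
      using ct unfolding y_def by (intro divide_left_mono) auto
    ultimately show "\<omega> \<in> ?R (y j)" by auto
  qed
  then have "(\<lambda>j. prob (?R (y j))) \<longlonglongrightarrow> prob (\<Inter>j. ?R (y j))"
    using t by (intro finite_Lim_measure_decseq image_subsetI running_max_event) simp_all
  also have "(\<Inter>j. ?R (y j)) = ?R 0"
  proof (intro equalityI subsetI)
    fix \<omega> assume "\<omega> \<in> (\<Inter>j. ?R (y j))"
    then have "running_max (telegraph N V0) t \<omega> \<le> y j" and "\<omega> \<in> ?R (y 0)" for j by auto
    moreover from this have "running_max (telegraph N V0) t \<omega> \<le> 0"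
      by (intro LIMSEQ_le_const[OF y_lim]) auto
    ultimately show "\<omega> \<in> ?R 0" by auto
  next
    fix \<omega> assume "\<omega> \<in> ?R 0"
    then show "\<omega> \<in> (\<Inter>j. ?R (y j))" using less_imp_le[OF y(1)] by (auto intro: order_trans)
  qed
  finally have "(\<lambda>j. prob (?R (y j))) \<longlonglongrightarrow> prob (?R 0)" .
  moreover have "(\<lambda>j. prob (?R (y j))) \<longlonglongrightarrow>
      prob {\<omega> \<in> space M. V0 \<omega> = - c \<and> N t \<omega> = n} * signed_binomial n ((c * t - 0) / (2 * c * t))"
    unfolding prob_running_max_le_pos[OF t y] signed_binomial_def
    using ct by (intro tendsto_intros y_lim) auto
  ultimately show ?thesis
    unfolding True by (rule LIMSEQ_unique)
qed

lemma prob_down_and_count_pos: "0 < t \<Longrightarrow> 0 < prob {\<omega> \<in> space M. V0 \<omega> = - c \<and> N t \<omega> = n}"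
  using rate_pos by (simp add: prob_down_and_count)

section \<open>The atom at zero and the density\<close>

text \<open>The process starts at 0, so its maximum is nonnegative and vanishes exactly when it is
  at most 0; the success probability at level 0 is \<open>1 / 2\<close>.\<close>

lemma cond_prob_running_max_eq_0:
  assumes t: "0 < t"
  shows "\<P>(\<omega> in M. running_max (telegraph N V0) t \<omega> = 0 \<bar> V0 \<omega> = - c \<and> N t \<omega> = 2 * k) =
    real ((2 * k) choose k) * (1 / 2 ^ (2 * k))"
proof -
  have "{\<omega> \<in> space M. running_max (telegraph N V0) t \<omega> = 0 \<and> V0 \<omega> = - c \<and> N t \<omega> = 2 * k} =
    {\<omega> \<in> space M. V0 \<omega> = - c \<and> N t \<omega> = 2 * k \<and> running_max (telegraph N V0) t \<omega> \<le> 0}"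
    using running_max_nonneg[of _ t] t by force
  moreover have "(c * t - 0) / (2 * c * t) = 1 / 2" using c_pos t by simp
  ultimately show ?thesis
    using prob_running_max_le[OF t order.refl, of "2 * k"] prob_down_and_count_pos[OF t, of "2 * k"] c_pos t
    unfolding cond_prob_def by (simp add: signed_binomial_half)
qed

lemma cond_law_running_max:
  fixes k :: nat and t :: real
  defines "A \<equiv> \<lambda>\<omega>. V0 \<omega> = - c \<and> N t \<omega> = 2 * k"
  assumes t: "0 < t"
  shows "finite_borel_measure (cond_law M (running_max (telegraph N V0) t) A)"
    and "0 \<le> x \<Longrightarrow> x < c * t \<Longrightarrow>
      measure (cond_law M (running_max (telegraph N V0) t) A) {..x} =
        signed_binomial (2 * k) ((c * t - x) / (2 * c * t))"
proof -
  let ?A = "{\<omega> \<in> space M. A \<omega>}" and ?X = "running_max (telegraph N V0) t"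
  have A: "?A \<in> events" "0 < prob ?A"
    using down_and_count_event[of t "2 * k"] prob_down_and_count_pos[OF t, of "2 * k"] t by (auto simp: A_def)
  then have A_ne: "emeasure M ?A \<noteq> 0" by (simp add: emeasure_eq_measure)
  have X[measurable]: "?X \<in> borel_measurable M"
    using running_max_measurable t by simp
  have "prob_space (uniform_measure M ?A)"
    using A_ne by (intro prob_space_uniform_measure) auto
  then have "prob_space (cond_law M ?X A)"
    unfolding cond_law_def by (rule prob_space.prob_space_distr) simp
  then show "finite_borel_measure (cond_law M ?X A)"
    by (intro finite_borel_measure.intro finite_borel_measure_axioms.intro prob_space.finite_measure)
       (auto simp: cond_law_def)
  assume x: "0 \<le> x" "x < c * t"
  have "measure (cond_law M ?X A) {..x} = measure (uniform_measure M ?A) (?X -` {..x} \<inter> space M)"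
    unfolding cond_law_def by (subst measure_distr) auto
  also have "\<dots> = prob (?A \<inter> (?X -` {..x} \<inter> space M)) / prob ?A"
    using A_ne by (intro measure_uniform_measure) auto
  also have "?A \<inter> (?X -` {..x} \<inter> space M) = {\<omega> \<in> space M. V0 \<omega> = - c \<and> N t \<omega> = 2 * k \<and> ?X \<omega> \<le> x}"
    by (auto simp: A_def)
  finally show "measure (cond_law M ?X A) {..x} = signed_binomial (2 * k) ((c * t - x) / (2 * c * t))"
    using prob_running_max_le[OF t x, of "2 * k"] A(2) by (simp add: A_def)
qed

text \<open>The density is the derivative of the conditional distribution function. The inner
  derivative \<open>- (1 / (2 * c * t))\<close> cancels the minus sign of
  \<open>DERIV_signed_binomial_even\<close>.\<close>

lemma running_max_has_density:
  assumes t: "0 < t" and k: "1 \<le> k"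
  shows "has_density_on
    (cond_law M (running_max (telegraph N V0) t) (\<lambda>\<omega>. V0 \<omega> = - c \<and> N t \<omega> = 2 * k))
    (\<lambda>\<beta>. 2 * fact (2 * k) / (fact k * fact (k - 1)) *
      ((c\<^sup>2 * t\<^sup>2 - \<beta>\<^sup>2) ^ (k - 1) * (c * t - \<beta>) / (2 * c * t) ^ (2 * k)))
    {0<..<c * t}"
    (is "has_density_on ?\<mu> ?f _")
proof (rule has_density_on_Ioo)
  let ?F = "\<lambda>x. signed_binomial (2 * k) ((c * t - x) / (2 * c * t))"
  have ct: "0 < c * t" using c_pos t by simp
  show fb: "finite_borel_measure ?\<mu>"
    by (rule cond_law_running_max(1)[OF t])
  show "0 < c * t" by (rule ct)
  show "?f \<in> borel_measurable borel" by measurable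
  show "(?F has_real_derivative ?f x) (at x)" for x
  proof -
    let ?p = "(c * t - x) / (2 * c * t)"
    have "((\<lambda>x. (c * t - x) / (2 * c * t)) has_real_derivative - (1 / (2 * c * t))) (at x)"
      using ct by (auto intro!: derivative_eq_intros)
    from DERIV_chain2[OF DERIV_signed_binomial_even[OF k] this]
    have "(?F has_real_derivative - (2 * real k * real (2 * k choose k) * ?p ^ k * (1 - ?p) ^ (k - 1))
      * - (1 / (2 * c * t))) (at x)" .
    moreover have "- (2 * real k * real (2 * k choose k) * ?p ^ k * (1 - ?p) ^ (k - 1)) * - (1 / (2 * c * t)) = ?f x"
    proof -
      have q: "1 - ?p = (c * t + x) / (2 * c * t)" using c_pos t by (simp add: field_simps)
      have "real (2 * k choose k) = fact (2 * k) / (fact k * fact k)"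
        by (simp add: binomial_fact)
      moreover have "(fact k :: real) = real k * fact (k - 1)"
        using k by (simp add: fact_reduce)
      moreover have "2 * real k * (a / (real k * b * (real k * b))) = 2 * a / (real k * b * b)" for a b :: real
        using k by simp
      ultimately have coeff: "2 * real k * real (2 * k choose k) = 2 * fact (2 * k) / (fact k * fact (k - 1))"
        by (simp only:)
      have square: "c\<^sup>2 * t\<^sup>2 - x\<^sup>2 = (c * t - x) * (c * t + x)"
        by (simp add: power2_eq_square algebra_simps)
      \<comment> \<open>Applied with \<open>P = c * t - x\<close>, \<open>Q = c * t + x\<close> and
        \<open>D = 2 * c * t\<close>; the last factor \<open>1 / D\<close> comes from the chain
        rule.\<close>
      have powers: "(P * Q) ^ (k - 1) * P / D ^ (2 * k) = (P / D) ^ k * (Q / D) ^ (k - 1) * (1 / D)"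
        for P Q D :: real
      proof -
        have pred: "y ^ (k - 1) * y = y ^ k" for y :: real
          using k by (intro power_minus_mult) simp
        have "D ^ (2 * k) = D ^ k * (D ^ (k - 1) * D)"
          unfolding pred by (simp add: mult_2 power_add)
        moreover have "(P * Q) ^ (k - 1) * P = P ^ k * Q ^ (k - 1)"
          unfolding pred[of P, symmetric] power_mult_distrib by (simp only: ac_simps)
        ultimately show ?thesis
          by (simp add: power_divide)
      qed
      have "- (C * X * Y) * - (1 / D) = C * (X * Y * (1 / D))" for C X Y D :: real by simp
      then show ?thesis
        unfolding square powers coeff q .
    qed
    ultimately show ?thesis by simp
  qed
  show "0 \<le> ?f x" if "0 \<le> x" "x \<le> c * t" for x
  proof -
    have "x\<^sup>2 \<le> (c * t)\<^sup>2" using that by (intro power_mono) auto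
    then have "0 \<le> c\<^sup>2 * t\<^sup>2 - x\<^sup>2" by (simp add: power_mult_distrib)
    then show ?thesis using that c_pos t by simp
  qed
  show "measure ?\<mu> {0<..x} = ?F x - ?F 0" if "0 < x" "x < c * t" for x
  proof -
    interpret law: finite_borel_measure ?\<mu> by (rule fb)
    \<comment> \<open>Subtracting the value at 0 removes the atom there.\<close>
    have "{0<..x} = {..x} - {..0}" by auto
    then have "measure ?\<mu> {0<..x} = measure ?\<mu> {..x} - measure ?\<mu> {..0}"
      using that by (simp only:) (rule law.finite_measure_Diff; simp add: law.sets_M)
    then show ?thesis
      using that ct cond_law_running_max(2)[OF t] by simp
  qed
qed

end

theorem theorem4p1:
  fixes M :: "'a measure" and rate c t :: real
    and N :: "real \<Rightarrow> 'a \<Rightarrow> nat" and V0 :: "'a \<Rightarrow> real"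
  assumes "symmetric_telegraph M rate N c V0" and "t > 0"
  shows "(\<forall>k::nat. k \<ge> 1 \<longrightarrow>
      has_density_on
        (cond_law M (running_max (telegraph N V0) t) (\<lambda>\<omega>. V0 \<omega> = - c \<and> N t \<omega> = 2 * k))
        (\<lambda>\<beta>. 2 * fact (2 * k) / (fact k * fact (k - 1)) *
          ((c\<^sup>2 * t\<^sup>2 - \<beta>\<^sup>2) ^ (k - 1) * (c * t - \<beta>) / (2 * c * t) ^ (2 * k)))
        {0<..<c * t}) \<and>
    (\<forall>k::nat.
      \<P>(\<omega> in M. running_max (telegraph N V0) t \<omega> = 0 \<bar> V0 \<omega> = - c \<and> N t \<omega> = 2 * k) =
        real ((2 * k) choose k) * (1 / 2 ^ (2 * k)))"
proof -
  interpret symmetric_telegraph M rate N c V0 by fact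
  show ?thesis
    using running_max_has_density cond_prob_running_max_eq_0 \<open>t > 0\<close> by blast
qed

end
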